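(* Let $(X^\circ,s)$ be an $A_1$ surface singularity, let $\tau\colon Y^\circ\to X^\circ$ be a minimal resolution, and let $m\ge1$. Then $$\chi^0(s,S^m\Omega^1_{Y^\circ})=\begin{cases} \frac{11}{108}m^3+\frac{11}{36}m^2+\frac16m & m\equiv0\pmod6\\ \frac{11}{108}m^3+\frac{11}{36}m^2-\frac1{12}m-\frac{35}{108} & m\equiv1\pmod6\\ \frac{11}{108}m^3+\frac{11}{36}m^2+\frac7{18}m+\frac5{27} & m\equiv2\pmod6\\ \frac{11}{108}m^3+\frac{11}{36}m^2-\frac1{12}m-\frac14 & m\equiv3\pmod6\\ \frac{11}{108}m^3+\frac{11}{36}m^2+\frac16m-\frac2{27} & m\equiv4\pmod6\\ \frac{11}{108}m^3+\frac{11}{36}m^2+\frac5{36}m-\frac7{108} & m\equiv5\pmod6. \end{cases}$$ In particular, for $m=1,2,\ldots,12$ the values are $0,3,5,12,21,34,49,75,98,134,174,222$.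
   Context: An $A_1$ singularity is modelled by the (complex) quadric cone $X^\circ=\{x_1x_3=x_2^2\}\subset\mathbb{A}^3$ with vertex $s=(0,0,0)$; the minimal resolution $Y^\circ$ is the blow-up of the vertex, with exceptional curve $E_s\simeq\mathbb{P}^1$, $E_s^2=-2$. $S^m\Omega^1_{Y^\circ}$ is the $m$-th symmetric power of the cotangent sheaf, and $$\chi^0(s,S^m\Omega^1_{Y^\circ}):=\dim\big[H^0(Y^\circ-E_s,S^m\Omega^1_{Y^\circ})/H^0(Y^\circ,S^m\Omega^1_{Y^\circ})\big].$$ *)

theory Defs
  imports
    Complex_Main
    "HOL-Computational_Algebra.Computational_Algebra"
    "HOL-Computational_Algebra.Field_as_Ring"
    "HOL-Library.Poly_Mapping"
    "HOL-Library.Function_Algebras"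
    "HOL-Library.Extended_Real"
begin

section \<open>The quadric cone and its blow-up\<close>

text \<open>
  The cone \<open>X = {x1 * x3 = x2^2}\<close> is integral with function field \<open>\<complex>(x1, x2)\<close>, in which
  \<open>x3 = x2^2 / x1\<close>.  All coordinate rings below are \<open>\<complex>\<close>-subalgebras of this field.
\<close>

type_synonym funfield = "complex poly poly fract"

definition const :: "complex \<Rightarrow> funfield" where
  "const c = to_fract [:[:c:]:]"

datatype idx = I1 | I2 | I3

fun coord :: "idx \<Rightarrow> funfield" where
  "coord I1 = to_fract [:[:0, 1:]:]"
| "coord I2 = to_fract [:0, 1:]"
| "coord I3 = to_fract [:0, 1:] ^ 2 / to_fract [:[:0, 1:]:]"

text \<open>
  The kernel of \<open>\<complex>[X1, X2, X3] \<rightarrow> \<complex>(x1, x2)\<close>, \<open>Xi \<mapsto> xi\<close>, is the ideal generated by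
  \<open>X1 * X3 - X2^2\<close>, so that \<open>\<complex>[x1, x2, x3]\<close> is indeed the coordinate ring of the cone.
\<close>

lemma cone_relation_generates_kernel:
  fixes P :: "complex poly poly poly"
  defines "X1 \<equiv> [:[:[:0, 1:]:]:]" and "X2 \<equiv> [:[:0, 1:]:]" and "X3 \<equiv> [:0, 1:]"
  shows "poly (map_poly to_fract P) (coord I3) = 0 \<longleftrightarrow> X1 * X3 - X2 ^ 2 dvd P"
proof -
  define Q :: "complex poly poly poly" where "Q = [:- ([:0, 1:] ^ 2), [:[:0, 1:]:]:]"
  have Q: "X1 * X3 - X2 ^ 2 = Q"
    by (simp add: X1_def X2_def X3_def Q_def power2_eq_square)
  have nz: "coord I1 \<noteq> 0" by simp
  have "coord I1 * coord I3 = to_fract [:0, 1:] ^ 2"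
    by simp
  also have "\<dots> = to_fract ([:0, 1:] ^ 2)"
    by (simp only: power2_eq_square to_fract_mult)
  finally have x1x3: "coord I1 * coord I3 = to_fract ([:0, 1:] ^ 2)" .
  have x1: "to_fract [:[:0, 1:]:] = coord I1" by simp
  have Qf: "map_poly to_fract Q = smult (coord I1) [:- coord I3, 1:]"
    by (simp add: Q_def map_poly_pCons x1 flip: x1x3 del: coord.simps)
  have "content Q dvd coeff Q n" for n
    by (rule content_dvd_coeff)
  from this[of 1] this[of 0]
  have d1: "content Q dvd [:[:0, 1:]:]" and d0: "content Q dvd [:0, 1:] ^ 2"
    by (simp_all add: Q_def)
  from d1 have "degree (content Q) = 0"
    using dvd_imp_degree_le[OF d1] by simp
  then obtain h where h: "content Q = [:h:]" by (elim degree_eq_zeroE)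
  from d0 have "h dvd coeff ([:0, 1:] ^ 2) 2"
    unfolding h const_poly_dvd_iff by blast
  also have "coeff ([:0, 1:] ^ 2) 2 = (1 :: complex poly)"
    by (simp add: power2_eq_square numeral_2_eq_2)
  finally have "is_unit (content Q)" by (simp add: h is_unit_const_poly_iff)
  then have content: "content Q = 1" by simp
  have "poly (map_poly to_fract P) (coord I3) = 0 \<longleftrightarrow> [:- coord I3, 1:] dvd map_poly to_fract P"
    by (rule poly_eq_0_iff_dvd)
  also have "\<dots> \<longleftrightarrow> map_poly to_fract Q dvd map_poly to_fract P"
    unfolding Qf using nz by (simp only: smult_dvd_iff) simp
  also have "\<dots> \<longleftrightarrow> Q dvd P"
    using content fract_poly_dvdD fract_poly_dvd by blast
  finally show ?thesis by (simp only: Q)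
qed

inductive_set subalgebra_gen :: "funfield set \<Rightarrow> funfield set" for G where
  gen: "a \<in> G \<Longrightarrow> a \<in> subalgebra_gen G"
| const: "const c \<in> subalgebra_gen G"
| add: "a \<in> subalgebra_gen G \<Longrightarrow> b \<in> subalgebra_gen G \<Longrightarrow> a + b \<in> subalgebra_gen G"
| mult: "a \<in> subalgebra_gen G \<Longrightarrow> b \<in> subalgebra_gen G \<Longrightarrow> a * b \<in> subalgebra_gen G"

definition cone_ring :: "funfield set" where
  "cone_ring = subalgebra_gen (range coord)"

text \<open>
  The vertex \<open>s\<close> is the zero locus of \<open>(x1, x2, x3)\<close>.  Its blow-up \<open>Y\<close> is covered by the affine
  charts \<open>Spec A[x1/xi, x2/xi, x3/xi]\<close>, where \<open>A\<close> is the coordinate ring of the cone.  On the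
  \<open>i\<close>-th chart the exceptional curve \<open>E\<close> has the equation \<open>xi = 0\<close>, so \<open>Y - E\<close> is covered by
  the spectra of the localisations at \<open>xi\<close>.
\<close>

definition blowup_chart :: "idx \<Rightarrow> funfield set" where
  "blowup_chart i = subalgebra_gen (cone_ring \<union> range (\<lambda>j. coord j / coord i))"

definition blowup_minus_E_chart :: "idx \<Rightarrow> funfield set" where
  "blowup_minus_E_chart i = subalgebra_gen (blowup_chart i \<union> {inverse (coord i)})"


section \<open>Symmetric differentials\<close>

text \<open>
  For a \<open>\<complex>\<close>-algebra \<open>S\<close>, the symmetric algebra over \<open>S\<close> of the module of Kaehler differentials of
  \<open>S\<close> over \<open>\<complex>\<close> is the quotient of the polynomial ring over \<open>S\<close> in the variables \<open>d a\<close>, one for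
  each \<open>a \<in> S\<close>, by the ideal generated by the linear forms \<open>d c\<close> (for \<open>c \<in> \<complex>\<close>),
  \<open>d (a + b) - d a - d b\<close> and \<open>d (a * b) - a * d b - b * d a\<close>.  Its part of degree \<open>m\<close> is the
  \<open>m\<close>-th symmetric power of the module of differentials.
\<close>

type_synonym diff_poly = "(funfield \<Rightarrow>\<^sub>0 nat) \<Rightarrow>\<^sub>0 funfield"

definition coeff_poly :: "funfield \<Rightarrow> diff_poly" where
  "coeff_poly a = Poly_Mapping.single 0 a"

definition differential :: "funfield \<Rightarrow> diff_poly" where
  "differential a = Poly_Mapping.single (Poly_Mapping.single a 1) 1"

definition diff_polys :: "funfield set \<Rightarrow> diff_poly set" where
  "diff_polys S = {f. \<forall>\<mu>\<in>Poly_Mapping.keys f. Poly_Mapping.lookup f \<mu> \<in> S \<and> Poly_Mapping.keys \<mu> \<subseteq> S}"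

definition homogeneous_diff_polys :: "nat \<Rightarrow> funfield set \<Rightarrow> diff_poly set" where
  "homogeneous_diff_polys m S =
     {f \<in> diff_polys S. \<forall>\<mu>\<in>Poly_Mapping.keys f.
        (\<Sum>a\<in>Poly_Mapping.keys \<mu>. Poly_Mapping.lookup \<mu> a) = m}"

inductive_set kaehler_ideal :: "funfield set \<Rightarrow> diff_poly set" for S where
  d_const: "differential (const c) \<in> kaehler_ideal S"
| d_add: "a \<in> S \<Longrightarrow> b \<in> S \<Longrightarrow> differential (a + b) - differential a - differential b \<in> kaehler_ideal S"
| d_mult: "a \<in> S \<Longrightarrow> b \<in> S \<Longrightarrow>
    differential (a * b) - coeff_poly a * differential b - coeff_poly b * differential a \<in> kaehler_ideal S"
| add: "f \<in> kaehler_ideal S \<Longrightarrow> g \<in> kaehler_ideal S \<Longrightarrow> f + g \<in> kaehler_ideal S"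
| mult: "f \<in> diff_polys S \<Longrightarrow> g \<in> kaehler_ideal S \<Longrightarrow> f * g \<in> kaehler_ideal S"


section \<open>Global sections\<close>

text \<open>
  Let \<open>R\<close> be the family of coordinate rings of an affine open cover, indexed by \<open>idx\<close>, of an
  integral separated scheme with function field \<open>funfield\<close>.  The intersection of the \<open>i\<close>-th and
  \<open>j\<close>-th open set is affine, and its coordinate ring is generated by \<open>R i\<close> and \<open>R j\<close>.
  A global section of \<open>S^m \<Omega>^1\<close> is a family of elements of the symmetric powers over the \<open>R i\<close>
  which agree over the intersections.  Elements of the symmetric powers are represented by
  polynomials throughout: \<open>sym_sections m R\<close> consists of the representatives of global sections,
  \<open>zero_sections m R\<close> of the representatives of the zero section, and the space of global sections
  is the quotient of the former by the latter.
\<close>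

definition sym_sections :: "nat \<Rightarrow> (idx \<Rightarrow> funfield set) \<Rightarrow> (idx \<Rightarrow> diff_poly) set" where
  "sym_sections m R =
     {\<omega>. (\<forall>i. \<omega> i \<in> homogeneous_diff_polys m (R i)) \<and>
         (\<forall>i j. \<omega> i - \<omega> j \<in> kaehler_ideal (subalgebra_gen (R i \<union> R j)))}"

definition zero_sections :: "nat \<Rightarrow> (idx \<Rightarrow> funfield set) \<Rightarrow> (idx \<Rightarrow> diff_poly) set" where
  "zero_sections m R = {\<omega>. \<forall>i. \<omega> i \<in> homogeneous_diff_polys m (R i) \<inter> kaehler_ideal (R i)}"

text \<open>
  \<open>quot_basis V W B\<close> says that \<open>b \<mapsto> b + W\<close> maps \<open>B\<close> injectively onto a finite basis of the
  quotient space \<open>V / W\<close>.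
\<close>

definition quot_basis ::
  "('k::field \<Rightarrow> 'v::ab_group_add \<Rightarrow> 'v) \<Rightarrow> 'v set \<Rightarrow> 'v set \<Rightarrow> 'v set \<Rightarrow> bool" where
  "quot_basis scale V W B \<longleftrightarrow> finite B \<and> B \<subseteq> V \<and>
     (\<forall>v\<in>V. \<exists>u. v - (\<Sum>b\<in>B. scale (u b) b) \<in> W) \<and>
     (\<forall>u. (\<Sum>b\<in>B. scale (u b) b) \<in> W \<longrightarrow> (\<forall>b\<in>B. u b = 0))"

definition quot_dim :: "('k::field \<Rightarrow> 'v::ab_group_add \<Rightarrow> 'v) \<Rightarrow> 'v set \<Rightarrow> 'v set \<Rightarrow> enat" where
  "quot_dim scale V W =
     (if \<exists>B. quot_basis scale V W B then enat (card (SOME B. quot_basis scale V W B)) else \<infinity>)"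

definition scale_section :: "complex \<Rightarrow> (idx \<Rightarrow> diff_poly) \<Rightarrow> (idx \<Rightarrow> diff_poly)" where
  "scale_section c \<omega> = (\<lambda>i. coeff_poly (const c) * \<omega> i)"

lemma vector_space_scale_section: "vector_space scale_section"
proof
  have single: "Poly_Mapping.single 0 a * Poly_Mapping.single 0 b = (Poly_Mapping.single 0 (a * b) :: diff_poly)" for a b
    by (simp add: mult_single)
  show "scale_section a (x + y) = scale_section a x + scale_section a y" for a x y
    by (simp add: scale_section_def fun_eq_iff algebra_simps)
  show "scale_section (a + b) x = scale_section a x + scale_section b x" for a b x
  proof -
    have "const (a + b) = const a + const b"
      by (simp add: const_def flip: to_fract_add)
    then show ?thesis
      by (simp add: scale_section_def fun_eq_iff coeff_poly_def single_add distrib_right)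
  qed
  show "scale_section a (scale_section b x) = scale_section (a * b) x" for a b x
    by (simp add: scale_section_def fun_eq_iff coeff_poly_def const_def single
        flip: mult.assoc to_fract_mult)
  show "scale_section 1 x = x" for x
    by (simp add: scale_section_def fun_eq_iff coeff_poly_def const_def flip: one_pCons)
qed

text \<open>
  The restriction map from \<open>Y\<close> to \<open>Y - E\<close> is the identity on representatives.  The last argument
  of \<open>quot_dim\<close> therefore represents the image of the sections over \<open>Y\<close>, modulo which the
  dimension is taken.
\<close>

definition chi0 :: "nat \<Rightarrow> enat" where
  "chi0 m = quot_dim scale_section
     (sym_sections m blowup_minus_E_chart)
     {\<rho> + \<zeta> | \<rho> \<zeta>. \<rho> \<in> sym_sections m blowup_chart \<and> \<zeta> \<in> zero_sections m blowup_minus_E_chart}"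

end

theory Submission
  imports Defs "HOL-Library.Product_Plus"
begin

text \<open>
  Put \<open>x = x1\<close> and \<open>t = x2/x1\<close>.  All coordinate rings of the charts of \<open>Y\<close> and of \<open>Y - E\<close>, and of
  their intersections, are spanned by monomials \<open>x^a t^b\<close>, so everything is graded by the torus
  weights \<open>(a, b)\<close>.  Written in \<open>dx/x\<close> and \<open>dt/t\<close>, the component of a symmetric differential of weight
  \<open>(a, b)\<close> is \<open>x^a t^b\<close> times a binary form of degree \<open>m\<close>, dehomogenised to a polynomial \<open>p(T)\<close> by
  \<open>dx/x = 1\<close>, \<open>dt/t = T\<close>.  The chart with coordinates \<open>x, t\<close> bounds the degree of \<open>p\<close> by \<open>b\<close>; the chart with
  coordinates \<open>x t^2, 1/t\<close>, where \<open>d(x t^2)/(x t^2) = 1 + 2 T\<close>, forces \<open>p\<close> to be divisible by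
  \<open>(1 + 2 T)^(m - 2 a + b)\<close>; and regularity along \<open>E\<close> means in every chart that \<open>T^(m - a)\<close> divides \<open>p\<close>.
  As \<open>T\<close> and \<open>1 + 2 T\<close> are coprime, the forms \<open>(1 + 2 T)^(m - 2 a + b) T^i\<close> with \<open>i < m - a\<close> and degree at
  most \<open>min m b\<close> are a basis of the quotient in weight \<open>(a, b)\<close>, and it remains to count them.
\<close>

section \<open>Evaluation of polynomials with coefficients in a subring\<close>

text \<open>The obstacle is the encoding of differentials: polynomials in infinitely many variables
  \<open>differential a\<close>, modulo an ideal known only by its generators, so that
  non-membership in the ideal is hard to see. The remedy is the evaluation \<open>Ev.eval\<close>,
  which sends \<open>differential a\<close> to the derivative of the Laurent polynomial
  \<open>a\<close>. It kills the ideal because \<open>D\<close> is a derivation. Conversely, on each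
  chart every homogeneous polynomial reduces modulo the ideal to a combination of products of the
  two coordinate differentials, and the evaluation is injective on such combinations because the
  binary forms involved are linearly independent. Hence in degree \<open>m\<close> the ideal is
  exactly the kernel, and sections, gluing and zero sections all turn into statements about a single
  Laurent polynomial with coefficients in \<complex>[T]. The 2 in 1 + 2 T is the exponent in the
  transition x3 = x t^2 between the two outer charts, that is, -E^2.\<close>

abbreviation "lookup \<equiv> Poly_Mapping.lookup"
abbreviation "keys \<equiv> Poly_Mapping.keys"
abbreviation "single \<equiv> Poly_Mapping.single"

lemma sum_single_lookup:
  fixes f :: "'a \<Rightarrow>\<^sub>0 'b::comm_monoid_add"
  shows "(\<Sum>k\<in>keys f. single k (lookup f k)) = f"
proof (rule poly_mapping_eqI)
  fix j
  have "lookup (\<Sum>k\<in>keys f. single k (lookup f k)) j = (\<Sum>k\<in>keys f. if k = j then lookup f j else 0)"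
    by (auto simp: lookup_sum lookup_single when_def intro!: sum.cong)
  also have "\<dots> = lookup f j" by (simp add: in_keys_iff)
  finally show "lookup (\<Sum>k\<in>keys f. single k (lookup f k)) j = lookup f j" .
qed

text \<open>The \<open>single\<close> case concerns only the terms of \<open>f\<close> itself, so a
  hypothesis on the coefficients or keys of \<open>f\<close> can be used there without being carried
  through the induction.\<close>

lemma poly_mapping_sum_induct [case_names zero single add]:
  fixes f :: "'a \<Rightarrow>\<^sub>0 'b::comm_monoid_add"
  assumes "P 0" and "\<And>k. k \<in> keys f \<Longrightarrow> P (single k (lookup f k))"
    and "\<And>g h. P g \<Longrightarrow> P h \<Longrightarrow> P (g + h)"
  shows "P f"
proof -
  have "P (\<Sum>k\<in>K. single k (lookup f k))" if "finite K" "K \<subseteq> keys f" for K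
    using that by (induction K rule: finite_induct) (auto intro: assms)
  from this[of "keys f"] show ?thesis by (simp add: sum_single_lookup)
qed

definition with_coeffs :: "'b::zero set \<Rightarrow> ('a \<Rightarrow>\<^sub>0 'b) set" where
  "with_coeffs S = {f. \<forall>k. lookup f k \<in> S}"

locale subring_set =
  fixes S :: "'b::comm_ring_1 set"
  assumes zero_closed: "0 \<in> S" and one_closed: "1 \<in> S"
    and add_closed: "a \<in> S \<Longrightarrow> b \<in> S \<Longrightarrow> a + b \<in> S"
    and mult_closed: "a \<in> S \<Longrightarrow> b \<in> S \<Longrightarrow> a * b \<in> S"
    and uminus_closed: "a \<in> S \<Longrightarrow> - a \<in> S"
begin

lemma with_coeffs_add: "f \<in> with_coeffs S \<Longrightarrow> g \<in> with_coeffs S \<Longrightarrow> f + g \<in> with_coeffs S"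
  by (auto simp: with_coeffs_def lookup_add add_closed)

lemma with_coeffs_diff: "f \<in> with_coeffs S \<Longrightarrow> g \<in> with_coeffs S \<Longrightarrow> f - g \<in> with_coeffs S"
  unfolding with_coeffs_def diff_conv_add_uminus
  by (auto simp: lookup_add lookup_minus uminus_closed intro: add_closed simp del: add_uminus_conv_diff)

lemma with_coeffs_single: "c \<in> S \<Longrightarrow> single k c \<in> with_coeffs S"
  by (auto simp: with_coeffs_def lookup_single when_def zero_closed)

lemma with_coeffs_zero: "0 \<in> with_coeffs S"
  by (auto simp: with_coeffs_def zero_closed)

lemma with_coeffs_lookup: "f \<in> with_coeffs S \<Longrightarrow> lookup f k \<in> S"
  by (auto simp: with_coeffs_def)

lemma with_coeffs_sum: "(\<And>x. x \<in> A \<Longrightarrow> f x \<in> with_coeffs S) \<Longrightarrow> sum f A \<in> with_coeffs S"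
  by (induction A rule: infinite_finite_induct) (auto simp: with_coeffs_zero with_coeffs_add)

lemma with_coeffs_mult:
  fixes f g :: "'a::comm_monoid_add \<Rightarrow>\<^sub>0 'b"
  assumes "f \<in> with_coeffs S" "g \<in> with_coeffs S"
  shows "f * g \<in> with_coeffs S"
proof (induction f rule: poly_mapping_sum_induct)
  case zero
  show ?case by (simp add: with_coeffs_zero)
next
  case (single k)
  show ?case
  proof (induction g rule: poly_mapping_sum_induct)
    case zero
    show ?case by (simp add: with_coeffs_zero)
  next
    case (single l)
    show ?case
      by (simp add: mult_single with_coeffs_single mult_closed with_coeffs_lookup assms)
  qed (simp add: distrib_left with_coeffs_add)
qed (simp add: distrib_right with_coeffs_add)

end

text \<open>Additivity and multiplicativity of \<phi> are asked only on \<open>S\<close>, because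
  one instance uses \<kappa>, which is meaningful only on the Laurent ring. The two instances are
  the map from Laurent polynomials to the function field and the map from polynomials in
  differentials to forms.\<close>

locale poly_mapping_eval = subring_set S
  for S :: "'b::comm_ring_1 set" +
  fixes \<phi> :: "'b \<Rightarrow> 'c::comm_ring_1" and \<psi> :: "'a::comm_monoid_add \<Rightarrow> 'c"
  assumes hom_zero: "\<phi> 0 = 0" and hom_one: "\<phi> 1 = 1"
    and hom_add: "a \<in> S \<Longrightarrow> b \<in> S \<Longrightarrow> \<phi> (a + b) = \<phi> a + \<phi> b"
    and hom_mult: "a \<in> S \<Longrightarrow> b \<in> S \<Longrightarrow> \<phi> (a * b) = \<phi> a * \<phi> b"
    and char_zero: "\<psi> 0 = 1" and char_add: "\<psi> (k + l) = \<psi> k * \<psi> l"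
begin

definition eval :: "('a \<Rightarrow>\<^sub>0 'b) \<Rightarrow> 'c" where
  "eval f = (\<Sum>k\<in>keys f. \<phi> (lookup f k) * \<psi> k)"

lemma eval_superset:
  "finite K \<Longrightarrow> keys f \<subseteq> K \<Longrightarrow> eval f = (\<Sum>k\<in>K. \<phi> (lookup f k) * \<psi> k)"
  unfolding eval_def by (rule sum.mono_neutral_left) (auto simp: in_keys_iff hom_zero)

lemma eval_zero [simp]: "eval 0 = 0"
  by (simp add: eval_def)

lemma eval_single [simp]: "eval (single k c) = \<phi> c * \<psi> k"
  by (cases "c = 0") (simp_all add: eval_def hom_zero)

lemma eval_add:
  assumes "f \<in> with_coeffs S" "g \<in> with_coeffs S"
  shows "eval (f + g) = eval f + eval g"
proof -
  have fin: "finite (keys f \<union> keys g)" by simp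
  show ?thesis
    using keys_add[of f g]
    by (simp add: eval_superset[OF fin] lookup_add hom_add with_coeffs_lookup assms
        distrib_right sum.distrib)
qed

lemma eval_mult:
  assumes "f \<in> with_coeffs S" "g \<in> with_coeffs S"
  shows "eval (f * g) = eval f * eval g"
proof -
  \<comment> \<open>Membership is part of the induction claim because the sum case needs it for
    \<open>eval_add\<close>.\<close>
  have "f \<in> with_coeffs S \<and> eval (f * g) = eval f * eval g"
  proof (induction f rule: poly_mapping_sum_induct)
    case zero
    show ?case by (simp add: with_coeffs_zero)
  next
    case (single k)
    have k: "lookup f k \<in> S" by (simp add: with_coeffs_lookup assms)
    have "g \<in> with_coeffs S \<and>
      eval (single k (lookup f k) * g) = eval (single k (lookup f k)) * eval g"
    proof (induction g rule: poly_mapping_sum_induct)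
      case zero
      show ?case by (simp add: with_coeffs_zero)
    next
      case (single l)
      have "lookup g l \<in> S" by (simp add: with_coeffs_lookup assms)
      then show ?case
        using k by (simp add: mult_single with_coeffs_single hom_mult char_add mult_ac)
    next
      case (add g h)
      then show ?case
        using k by (simp add: distrib_left with_coeffs_add with_coeffs_mult with_coeffs_single
            eval_add)
    qed
    with k show ?case by (simp add: with_coeffs_single)
  next
    case (add f h)
    then show ?case
      by (simp add: distrib_right with_coeffs_add with_coeffs_mult eval_add assms)
  qed
  then show ?thesis ..
qed

lemma eval_diff:
  assumes "f \<in> with_coeffs S" "g \<in> with_coeffs S"
  shows "eval (f - g) = eval f - eval g"
  using eval_add[OF with_coeffs_diff[OF assms] assms(2)] by simp

lemma eval_sum: "(\<And>x. x \<in> A \<Longrightarrow> f x \<in> with_coeffs S) \<Longrightarrow> eval (sum f A) = (\<Sum>x\<in>A. eval (f x))"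
  by (induction A rule: infinite_finite_induct) (auto simp: eval_add with_coeffs_sum)

lemma eval_one: "eval 1 = 1"
  by (simp flip: single_one add: hom_one char_zero)

end

section \<open>Laurent monomials in the function field\<close>

type_synonym weight = "int \<times> int"

text \<open>The coefficient of weight \<open>(a, b)\<close> is the polynomial in \<open>T\<close> which multiplies \<open>x^a t^b\<close>.\<close>

type_synonym form = "weight \<Rightarrow>\<^sub>0 complex poly"

text \<open>With t = x2/x1 this is x^a t^b for the weight \<open>(a, b)\<close>.\<close>

definition mon :: "weight \<Rightarrow> funfield" where
  "mon w = coord I1 powi (fst w - snd w) * coord I2 powi snd w"

lemma coord_nonzero [simp]: "coord i \<noteq> 0"
  by (cases i) auto

lemma mon_add: "mon (v + w) = mon v * mon w"
proof -
  have "mon (v + w) = coord I1 powi ((fst v - snd v) + (fst w - snd w)) * coord I2 powi (snd v + snd w)"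
    by (simp add: mon_def algebra_simps del: coord.simps)
  also have "\<dots> = mon v * mon w"
    by (simp only: mon_def power_int_add coord_nonzero mult_ac simp_thms)
  finally show ?thesis .
qed

lemma mon_zero [simp]: "mon 0 = 1"
  by (simp add: mon_def)

lemma mon_nonzero [simp]: "mon w \<noteq> 0"
  by (simp add: mon_def del: coord.simps)

lemma mon_uminus: "mon (- w) = inverse (mon w)"
  by (metis add.right_inverse inverse_unique mon_add mon_zero)

lemma const_add: "const (a + b) = const a + const b"
  by (simp add: const_def flip: to_fract_add)

lemma const_mult: "const (a * b) = const a * const b"
  by (simp add: const_def flip: to_fract_mult)

lemma const_zero [simp]: "const 0 = 0" and const_one [simp]: "const 1 = 1"
  by (simp_all add: const_def flip: one_pCons)

lemma to_fract_power: "to_fract (p ^ n) = to_fract p ^ n"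
  by (induction n) (simp_all add: to_fract_mult)

text \<open>Functions share the type \<open>form\<close> with differentials: a Laurent polynomial is
  a form whose coefficients are constant in T. Reading off the constant coefficient is a ring
  homomorphism on all of \<complex>[T], so the subring can be \<open>UNIV\<close>.\<close>

interpretation toK: poly_mapping_eval UNIV "\<lambda>p. const (coeff p 0)" mon
  rewrites "with_coeffs UNIV = UNIV"
  by unfold_locales (auto simp: const_add const_mult mon_add coeff_mult_0 with_coeffs_def)

definition scalar_forms :: "form set" where
  "scalar_forms = with_coeffs (range (\<lambda>c. [:c:]))"

lemma scalar_form_lookup: "f \<in> scalar_forms \<Longrightarrow> lookup f w = [:coeff (lookup f w) 0:]"
proof -
  assume "f \<in> scalar_forms"
  then have "lookup f w \<in> range (\<lambda>c. [:c:])" unfolding scalar_forms_def with_coeffs_def by blast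
  then show ?thesis by auto
qed

text \<open>Distinct Laurent monomials in x1 and x2 are linearly independent over \<complex>:
  multiplication by a large power of x1 x2 clears the denominators, after which coefficients of a
  polynomial in two variables can be compared.\<close>

lemma toK_eq_0D:
  assumes f: "f \<in> scalar_forms" and 0: "toK.eval f = 0"
  shows "f = 0"
proof (rule ccontr)
  assume "f \<noteq> 0"
  define N where "N = Max ((\<lambda>w. \<bar>fst w\<bar> + \<bar>snd w\<bar>) ` keys f)"
  have N: "\<bar>fst w\<bar> + \<bar>snd w\<bar> \<le> N" if "w \<in> keys f" for w
    unfolding N_def using that by (intro Max_ge) auto
  \<comment> \<open>The exponents of x1 and x2 after multiplication by (x1 x2)^N, whose weight is
    \<open>(2 * N, N)\<close>.\<close>
  define i where "i w = nat (fst w - snd w + N)" for w :: weight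
  define j where "j w = nat (snd w + N)" for w :: weight
  have i: "int (i w) = fst w - snd w + N" and j: "int (j w) = snd w + N" if "w \<in> keys f" for w
    using N[OF that] by (auto simp: i_def j_def)
  define c where "c w = coeff (lookup f w) 0" for w
  have shift: "to_fract (monom (monom (c w) (i w)) (j w)) = const (c w) * mon w * mon (2 * N, N)"
    if "w \<in> keys f" for w
  proof -
    have "monom (monom (c w) (i w)) (j w) = [:[:c w:]:] * [:[:0, 1:]:] ^ i w * [:0, 1:] ^ j w"
      by (simp add: monom_altdef poly_const_pow)
    then have "to_fract (monom (monom (c w) (i w)) (j w)) = const (c w) * coord I1 ^ i w * coord I2 ^ j w"
      by (simp only: const_def to_fract_mult to_fract_power coord.simps)
    also have "coord I1 ^ i w = coord I1 powi (fst w - snd w + N)"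
      using i[OF that] by (metis power_int_of_nat)
    also have "coord I2 ^ j w = coord I2 powi (snd w + N)"
      using j[OF that] by (metis power_int_of_nat)
    also have "const (c w) * coord I1 powi (fst w - snd w + N) * coord I2 powi (snd w + N)
      = const (c w) * (mon w * mon (2 * N, N))"
      by (simp only: mon_add[symmetric]) (simp add: mon_def plus_prod_def algebra_simps del: coord.simps)
    finally show ?thesis by (simp add: mult_ac)
  qed
  have "0 = toK.eval f * mon (2 * N, N)" using 0 by simp
  also have "\<dots> = to_fract (\<Sum>w\<in>keys f. monom (monom (c w) (i w)) (j w))"
    by (simp add: toK.eval_def sum_distrib_right to_fract_sum shift flip: c_def)
  finally have sum0: "(\<Sum>w\<in>keys f. monom (monom (c w) (i w)) (j w)) = 0"
    by (metis to_fract_eq_0_iff)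
  from \<open>f \<noteq> 0\<close> obtain v where v: "v \<in> keys f" by (metis ex_in_conv keys_eq_empty)
  have inj: "i w = i v \<and> j w = j v \<longleftrightarrow> w = v" if "w \<in> keys f" for w
    using i[OF that] j[OF that] i[OF v] j[OF v] by (auto simp: prod_eq_iff)
  have "0 = coeff (coeff (\<Sum>w\<in>keys f. monom (monom (c w) (i w)) (j w)) (j v)) (i v)"
    by (simp add: sum0)
  also have "\<dots> = (\<Sum>w\<in>keys f. if w = v then c v else 0)"
    unfolding coeff_sum by (rule sum.cong) (use inj in auto)
  also have "\<dots> = c v" using v by simp
  finally have "lookup f v = 0" using scalar_form_lookup[OF f, of v] by (simp add: c_def)
  with v show False by (simp add: in_keys_iff)
qed

interpretation scalar: subring_set "range (\<lambda>c::complex. [:c:])"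
proof
  show "1 \<in> range (\<lambda>c::complex. [:c:])" by (auto simp: one_pCons)
qed auto

lemma toK_inj: "inj_on toK.eval scalar_forms"
proof (rule inj_onI)
  fix f g assume fg: "f \<in> scalar_forms" "g \<in> scalar_forms" "toK.eval f = toK.eval g"
  have "toK.eval (f - g) = 0" using fg(3) by (simp add: toK.eval_diff)
  with fg show "f = g"
    using toK_eq_0D[of "f - g"] scalar.with_coeffs_diff unfolding scalar_forms_def by auto
qed

definition monring :: "weight set \<Rightarrow> funfield set" where
  "monring M = toK.eval ` {f \<in> scalar_forms. keys f \<subseteq> M}"

text \<open>The values of \<open>\<kappa>\<close> outside the Laurent ring \<open>monring UNIV\<close> are junk.\<close>

definition \<kappa> :: "funfield \<Rightarrow> form" where
  "\<kappa> = inv_into scalar_forms toK.eval"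

lemma \<kappa>_eval: "f \<in> scalar_forms \<Longrightarrow> \<kappa> (toK.eval f) = f"
  unfolding \<kappa>_def by (rule inv_into_f_f[OF toK_inj])

lemma monringD:
  assumes "a \<in> monring M"
  shows "\<kappa> a \<in> scalar_forms" "keys (\<kappa> a) \<subseteq> M" "toK.eval (\<kappa> a) = a"
  using assms by (auto simp: monring_def \<kappa>_eval)

lemma monringI: "f \<in> scalar_forms \<Longrightarrow> keys f \<subseteq> M \<Longrightarrow> toK.eval f \<in> monring M"
  by (auto simp: monring_def)

lemma monring_mono: "M \<subseteq> N \<Longrightarrow> monring M \<subseteq> monring N"
  by (auto simp: monring_def)

lemma scalar_forms_single: "single w [:c:] \<in> scalar_forms"
  unfolding scalar_forms_def by (rule scalar.with_coeffs_single) auto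

lemma scalar_forms_closed:
  assumes "f \<in> scalar_forms" "g \<in> scalar_forms"
  shows "f + g \<in> scalar_forms" "f * g \<in> scalar_forms" "f - g \<in> scalar_forms"
  using assms unfolding scalar_forms_def
  by (auto intro: scalar.with_coeffs_add scalar.with_coeffs_mult scalar.with_coeffs_diff)

lemma const_mon_in_monring: "w \<in> M \<Longrightarrow> const c * mon w \<in> monring M"
  using monringI[OF scalar_forms_single[of w c], of M] by (simp add: keys_single)

lemma \<kappa>_const: "\<kappa> (const c) = single 0 [:c:]"
  using \<kappa>_eval[OF scalar_forms_single, of 0 c] by simp

lemma \<kappa>_mon: "\<kappa> (mon w) = single w 1"
  using \<kappa>_eval[OF scalar_forms_single, of w 1] by (simp flip: one_pCons)

lemma monring_add: "a \<in> monring M \<Longrightarrow> b \<in> monring M \<Longrightarrow> a + b \<in> monring M"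
  and \<kappa>_add: "a \<in> monring M \<Longrightarrow> b \<in> monring M \<Longrightarrow> \<kappa> (a + b) = \<kappa> a + \<kappa> b"
proof -
  assume ab: "a \<in> monring M" "b \<in> monring M"
  then obtain f g where fg: "f \<in> scalar_forms" "keys f \<subseteq> M" "a = toK.eval f"
    "g \<in> scalar_forms" "keys g \<subseteq> M" "b = toK.eval g" by (auto simp: monring_def)
  have e: "a + b = toK.eval (f + g)" using fg by (simp add: toK.eval_add)
  show "a + b \<in> monring M"
    unfolding e using fg keys_add[of f g] by (intro monringI scalar_forms_closed) auto
  show "\<kappa> (a + b) = \<kappa> a + \<kappa> b"
    unfolding e using fg by (simp add: \<kappa>_eval scalar_forms_closed)
qed

lemma monring_mult:
    "(\<And>v w. v \<in> M \<Longrightarrow> w \<in> M \<Longrightarrow> v + w \<in> M) \<Longrightarrow> a \<in> monring M \<Longrightarrow> b \<in> monring M \<Longrightarrow> a * b \<in> monring M"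
  and \<kappa>_mult: "a \<in> monring M \<Longrightarrow> b \<in> monring M \<Longrightarrow> \<kappa> (a * b) = \<kappa> a * \<kappa> b"
proof -
  assume ab: "a \<in> monring M" "b \<in> monring M"
  then obtain f g where fg: "f \<in> scalar_forms" "keys f \<subseteq> M" "a = toK.eval f"
    "g \<in> scalar_forms" "keys g \<subseteq> M" "b = toK.eval g" by (auto simp: monring_def)
  have e: "a * b = toK.eval (f * g)" using fg by (simp add: toK.eval_mult)
  show "a * b \<in> monring M" if "\<And>v w. v \<in> M \<Longrightarrow> w \<in> M \<Longrightarrow> v + w \<in> M"
    unfolding e using fg keys_mult[of f g] that by (intro monringI scalar_forms_closed) blast+
  show "\<kappa> (a * b) = \<kappa> a * \<kappa> b"
    unfolding e using fg by (simp add: \<kappa>_eval scalar_forms_closed)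
qed

section \<open>Symmetric differentials as forms\<close>

text \<open>\<open>lin (a, b)\<close> is the logarithmic differential \<open>a dx/x + b dt/t\<close> of \<open>x^a t^b\<close>.\<close>

definition lin :: "weight \<Rightarrow> complex poly" where
  "lin w = [:of_int (fst w), of_int (snd w):]"

lemma lin_add: "lin (v + w) = lin v + lin w"
  by (simp add: lin_def)

definition D :: "form \<Rightarrow> form" where
  "D = Poly_Mapping.mapp (\<lambda>w p. lin w * p)"

lemma lookup_D: "lookup (D f) w = lin w * lookup f w"
  by (auto simp: D_def lookup_mapp when_def in_keys_iff)

lemma D_add: "D (f + g) = D f + D g"
  by (rule poly_mapping_eqI) (simp add: lookup_D lookup_add algebra_simps)

lemma D_zero [simp]: "D 0 = 0"
  by (rule poly_mapping_eqI) (simp add: lookup_D)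

lemma D_single: "D (single w p) = single w (lin w * p)"
  by (rule poly_mapping_eqI) (simp add: lookup_D lookup_single when_def)

text \<open>By bilinearity only single terms matter, and there the Leibniz rule is the additivity of
  \<open>lin\<close> in the weight.\<close>

lemma D_mult: "D (f * g) = f * D g + g * D f"
proof (induction f rule: poly_mapping_sum_induct)
  case (single k)
  show ?case
  proof (induction g rule: poly_mapping_sum_induct)
    case (single l)
    show ?case
      by (simp add: mult_single D_single lin_add algebra_simps flip: single_add)
  qed (simp_all add: D_add algebra_simps)
qed (simp_all add: D_add algebra_simps)

section \<open>Closure properties of generated subalgebras\<close>

lemma subalgebra_gen_least:
  assumes "G \<subseteq> subalgebra_gen H"
  shows "subalgebra_gen G \<subseteq> subalgebra_gen H"
proof
  fix a assume "a \<in> subalgebra_gen G"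
  then show "a \<in> subalgebra_gen H"
    by induction (use assms in \<open>auto intro: subalgebra_gen.intros\<close>)
qed

lemma subalgebra_gen_zero: "0 \<in> subalgebra_gen G"
  and subalgebra_gen_one: "1 \<in> subalgebra_gen G"
  using subalgebra_gen.const[of 0 G] subalgebra_gen.const[of 1 G] by simp_all

lemma subalgebra_gen_uminus: "a \<in> subalgebra_gen G \<Longrightarrow> - a \<in> subalgebra_gen G"
proof -
  assume a: "a \<in> subalgebra_gen G"
  have "const (- 1) + 1 = const (- 1 + 1)" by (simp only: const_add const_one)
  then have "const (- 1) = - 1" by (simp add: eq_neg_iff_add_eq_0)
  with subalgebra_gen.mult[OF subalgebra_gen.const[of "- 1"] a] show ?thesis by simp
qed

lemma subring_set_subalgebra_gen: "subring_set (subalgebra_gen G)"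
  by unfold_locales
    (auto intro: subalgebra_gen.intros subalgebra_gen_zero subalgebra_gen_one subalgebra_gen_uminus)

lemma subalgebra_gen_power: "a \<in> subalgebra_gen G \<Longrightarrow> a ^ n \<in> subalgebra_gen G"
  by (induction n) (auto intro: subalgebra_gen_one subalgebra_gen.mult)

lemma subalgebra_gen_sum: "(\<And>x. x \<in> A \<Longrightarrow> f x \<in> subalgebra_gen G) \<Longrightarrow> sum f A \<in> subalgebra_gen G"
  by (induction A rule: infinite_finite_induct) (auto intro: subalgebra_gen_zero subalgebra_gen.add)

interpretation laurent: subring_set "monring UNIV"
proof
  fix a b assume ab: "a \<in> monring UNIV" "b \<in> monring UNIV"
  from ab show "a + b \<in> monring UNIV" by (rule monring_add)
  from ab show "a * b \<in> monring UNIV" by (intro monring_mult) auto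
  from ab(1) obtain f where "f \<in> scalar_forms" "a = toK.eval f" by (auto simp: monring_def)
  then have "toK.eval (0 - f) \<in> monring UNIV"
    by (intro monringI scalar_forms_closed) (auto simp: scalar_forms_def scalar.with_coeffs_zero)
  then show "- a \<in> monring UNIV"
    using \<open>a = toK.eval f\<close> toK.eval_diff[of 0 f] by simp
next
  show "0 \<in> monring UNIV" using const_mon_in_monring[of 0 UNIV 0] by simp
  show "1 \<in> monring UNIV" using const_mon_in_monring[of 0 UNIV 1] by simp
qed

text \<open>The value of a monomial in the variables \<open>differential a\<close>. The variables
  are free, so multiplicativity holds for all of them, even where \<kappa> is junk; only
  coefficients have to be Laurent polynomials.\<close>

definition dmon :: "(funfield \<Rightarrow>\<^sub>0 nat) \<Rightarrow> form" where
  "dmon \<mu> = (\<Prod>a\<in>keys \<mu>. D (\<kappa> a) ^ lookup \<mu> a)"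

lemma dmon_superset: "finite K \<Longrightarrow> keys \<mu> \<subseteq> K \<Longrightarrow> dmon \<mu> = (\<Prod>a\<in>K. D (\<kappa> a) ^ lookup \<mu> a)"
  unfolding dmon_def by (rule prod.mono_neutral_left) (auto simp: in_keys_iff)

lemma dmon_add: "dmon (\<mu> + \<nu>) = dmon \<mu> * dmon \<nu>"
proof -
  have fin: "finite (keys \<mu> \<union> keys \<nu>)" by simp
  show ?thesis
    using keys_add[of \<mu> \<nu>]
    by (simp add: dmon_superset[OF fin] lookup_add power_add prod.distrib)
qed

interpretation Ev: poly_mapping_eval "monring UNIV" \<kappa> dmon
proof
  show "\<kappa> 0 = 0" "\<kappa> 1 = 1" using \<kappa>_const[of 0] \<kappa>_const[of 1] by (simp_all flip: one_pCons)
  show "dmon 0 = 1" by (simp add: dmon_def)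
qed (auto simp: dmon_add intro: \<kappa>_add \<kappa>_mult)

lemma Ev_coeff_poly: "Ev.eval (coeff_poly a) = \<kappa> a"
  by (simp add: coeff_poly_def Ev.char_zero)

lemma Ev_differential: "Ev.eval (differential a) = D (\<kappa> a)"
  by (simp add: differential_def dmon_def Ev.hom_one)

lemma coeff_poly_in: "a \<in> monring UNIV \<Longrightarrow> coeff_poly a \<in> with_coeffs (monring UNIV)"
  unfolding coeff_poly_def by (rule laurent.with_coeffs_single)

lemma differential_in: "differential a \<in> with_coeffs (monring UNIV)"
  unfolding differential_def by (rule laurent.with_coeffs_single[OF laurent.one_closed])

lemma diff_polys_with_coeffs:
  assumes "f \<in> diff_polys S" "S \<subseteq> T" "0 \<in> T"
  shows "f \<in> with_coeffs T"
  unfolding with_coeffs_def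
proof (intro CollectI allI)
  show "lookup f k \<in> T" for k
    using assms by (cases "k \<in> keys f") (auto simp: diff_polys_def in_keys_iff)
qed

text \<open>The generators evaluate to zero because \<open>D\<close> is a derivation that
  annihilates constants (\<open>lin 0 = 0\<close>). The claim about coefficients accompanies it so
  that \<open>Ev.eval\<close> is additive and multiplicative on the elements that occur.\<close>

lemma Ev_kaehler_ideal:
  assumes "f \<in> kaehler_ideal S" "S \<subseteq> monring UNIV"
  shows "f \<in> with_coeffs (monring UNIV) \<and> Ev.eval f = 0"
  using assms(1)
proof induction
  case (d_const c)
  have "lin 0 = 0" by (simp add: lin_def)
  then show ?case by (simp add: differential_in Ev_differential \<kappa>_const D_single)
next
  case (d_add a b)
  then have "a \<in> monring UNIV" "b \<in> monring UNIV" using assms(2) by auto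
  then show ?case
    by (simp add: laurent.with_coeffs_diff differential_in Ev.eval_diff Ev_differential \<kappa>_add D_add)
next
  case (d_mult a b)
  then have "a \<in> monring UNIV" "b \<in> monring UNIV" using assms(2) by auto
  then show ?case
    by (simp add: laurent.with_coeffs_diff laurent.with_coeffs_mult differential_in coeff_poly_in
        Ev.eval_diff Ev.eval_mult Ev_differential Ev_coeff_poly \<kappa>_mult D_mult)
next
  case (add f g)
  then show ?case by (simp add: laurent.with_coeffs_add Ev.eval_add)
next
  case (mult f g)
  have "f \<in> with_coeffs (monring UNIV)"
    using mult.hyps(1) assms(2) laurent.zero_closed by (rule diff_polys_with_coeffs)
  then show ?case using mult.IH by (simp add: laurent.with_coeffs_mult Ev.eval_mult)
qed

section \<open>Monomial charts\<close>

definition comb :: "weight \<Rightarrow> weight \<Rightarrow> int \<Rightarrow> int \<Rightarrow> weight" where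
  "comb v w i j = (i * fst v + j * fst w, i * snd v + j * snd w)"

lemma comb_add: "comb v w i j + comb v w k l = comb v w (i + k) (j + l)"
  by (simp add: comb_def algebra_simps)

lemma mon_comb: "mon (comb v w i j) = mon v powi i * mon w powi j"
proof -
  have "mon (comb v w i j) =
      coord I1 powi ((fst v - snd v) * i + (fst w - snd w) * j) * coord I2 powi (snd v * i + snd w * j)"
    by (simp add: mon_def comb_def algebra_simps del: coord.simps)
  also have "\<dots> = (coord I1 powi (fst v - snd v)) powi i * (coord I1 powi (fst w - snd w)) powi j *
      ((coord I2 powi snd v) powi i * (coord I2 powi snd w) powi j)"
    by (simp only: power_int_add coord_nonzero power_int_mult simp_thms)
  also have "\<dots> = mon v powi i * mon w powi j"
    by (simp only: mon_def power_int_mult_distrib mult_ac)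
  finally show ?thesis .
qed

text \<open>The flags tell which of the two coordinates are inverted.\<close>

definition chart_gens :: "weight \<Rightarrow> weight \<Rightarrow> bool \<Rightarrow> bool \<Rightarrow> funfield set" where
  "chart_gens v w bv bw = {mon v, mon w} \<union> (if bv then {inverse (mon v)} else {}) \<union>
     (if bw then {inverse (mon w)} else {})"

definition chart_cone :: "weight \<Rightarrow> weight \<Rightarrow> bool \<Rightarrow> bool \<Rightarrow> weight set" where
  "chart_cone v w bv bw = {comb v w i j | i j. (bv \<or> 0 \<le> i) \<and> (bw \<or> 0 \<le> j)}"

lemma mon_in_monring: "w \<in> M \<Longrightarrow> mon w \<in> monring M"
  using const_mon_in_monring[of w M 1] by simp

text \<open>All generators are monomials and the weights in \<open>chart_cone\<close> are closed
  under addition, so the algebra is spanned by monomials; conversely each such monomial is a product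
  of powers of generators.\<close>

lemma chart_ring: "subalgebra_gen (chart_gens v w bv bw) = monring (chart_cone v w bv bw)"
proof (rule antisym; rule subsetI)
  let ?M = "chart_cone v w bv bw" and ?G = "chart_gens v w bv bw"
  have M: "mon v powi i * mon w powi j \<in> monring ?M" if "bv \<or> 0 \<le> i" "bw \<or> 0 \<le> j" for i j
    unfolding mon_comb[symmetric] by (rule mon_in_monring) (use that in \<open>auto simp: chart_cone_def\<close>)
  have M_add: "x + y \<in> ?M" if xy: "x \<in> ?M" "y \<in> ?M" for x y
  proof -
    obtain i j where x: "x = comb v w i j" "bv \<or> 0 \<le> i" "bw \<or> 0 \<le> j"
      using xy(1) unfolding chart_cone_def by blast
    obtain k l where y: "y = comb v w k l" "bv \<or> 0 \<le> k" "bw \<or> 0 \<le> l"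
      using xy(2) unfolding chart_cone_def by blast
    show ?thesis
      unfolding chart_cone_def mem_Collect_eq x(1) y(1) comb_add
      by (rule exI[of _ "i + k"], rule exI[of _ "j + l"]) (use x y in auto)
  qed
  fix a
  show "a \<in> monring ?M" if "a \<in> subalgebra_gen ?G"
    using that
  proof induction
    case (gen a)
    then show ?case
      using M[of 1 0] M[of 0 1] M[of "-1" 0] M[of 0 "-1"]
      by (auto simp: chart_gens_def power_int_minus split: if_splits)
  next
    case (const c)
    have "0 \<in> ?M" by (auto simp: chart_cone_def comb_def zero_prod_def intro!: exI[of _ 0])
    then show ?case using const_mon_in_monring[of 0 ?M c] by simp
  qed (auto intro: monring_add monring_mult M_add)
  show "a \<in> subalgebra_gen ?G" if "a \<in> monring ?M"
  proof -
    have pw: "x powi i \<in> subalgebra_gen ?G"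
      if "x \<in> ?G" "b \<or> 0 \<le> i" "b \<Longrightarrow> inverse x \<in> ?G" for x i b
      using that by (auto simp: power_int_def intro: subalgebra_gen_power subalgebra_gen.gen)
    have "mon u \<in> subalgebra_gen ?G" if uM: "u \<in> ?M" for u
    proof -
      obtain i j where u: "u = comb v w i j" and ij: "bv \<or> 0 \<le> i" "bw \<or> 0 \<le> j"
        using uM unfolding chart_cone_def by blast
      show ?thesis
        unfolding u mon_comb
        by (intro subalgebra_gen.mult pw[OF _ ij(1)] pw[OF _ ij(2)]) (auto simp: chart_gens_def)
    qed
    then have "toK.eval (\<kappa> a) \<in> subalgebra_gen ?G"
      unfolding toK.eval_def using monringD(2)[OF that]
      by (intro subalgebra_gen_sum subalgebra_gen.mult subalgebra_gen.const) auto
    then show ?thesis using monringD(3)[OF that] by simp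
  qed
qed

section \<open>Normal forms of symmetric differentials\<close>

definition pdeg :: "(funfield \<Rightarrow>\<^sub>0 nat) \<Rightarrow> nat" where
  "pdeg \<mu> = (\<Sum>a\<in>keys \<mu>. lookup \<mu> a)"

lemma pdeg_add: "pdeg (\<mu> + \<nu>) = pdeg \<mu> + pdeg \<nu>"
  unfolding pdeg_def by (rule setsum_keys_plus_distrib) auto

lemma pdeg_single: "pdeg (single a n) = n"
  by (simp add: pdeg_def keys_single)

lemma diff_polys_alt:
  "0 \<in> S \<Longrightarrow> f \<in> diff_polys S \<longleftrightarrow> f \<in> with_coeffs S \<and> (\<forall>\<mu>\<in>keys f. keys \<mu> \<subseteq> S)"
  using diff_polys_with_coeffs[of f S S] by (auto simp: diff_polys_def with_coeffs_def)

lemma homogeneous_alt: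
  "f \<in> homogeneous_diff_polys m S \<longleftrightarrow> f \<in> diff_polys S \<and> (\<forall>\<mu>\<in>keys f. pdeg \<mu> = m)"
  by (auto simp: homogeneous_diff_polys_def pdeg_def)

section \<open>Homogeneous polynomials in differentials and the ideal of relations\<close>

context
  fixes S :: "funfield set"
  assumes S: "subring_set S"
begin

interpretation subring_set S by (rule S)

lemma diff_polys_zero: "0 \<in> diff_polys S"
  by (simp add: diff_polys_def)

lemma homogeneous_zero: "0 \<in> homogeneous_diff_polys m S"
  by (simp add: homogeneous_alt diff_polys_zero)

lemma diff_polys_add: "f \<in> diff_polys S \<Longrightarrow> g \<in> diff_polys S \<Longrightarrow> f + g \<in> diff_polys S"
  using keys_add[of f g] by (auto simp: diff_polys_alt zero_closed with_coeffs_add)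

lemma diff_polys_diff: "f \<in> diff_polys S \<Longrightarrow> g \<in> diff_polys S \<Longrightarrow> f - g \<in> diff_polys S"
  using keys_diff[of f g] by (auto simp: diff_polys_alt zero_closed with_coeffs_diff)

lemma diff_polys_mult: "f \<in> diff_polys S \<Longrightarrow> g \<in> diff_polys S \<Longrightarrow> f * g \<in> diff_polys S"
proof -
  assume f: "f \<in> diff_polys S" and g: "g \<in> diff_polys S"
  have "keys \<mu> \<subseteq> S" if "\<mu> \<in> keys (f * g)" for \<mu>
  proof -
    obtain \<alpha> \<beta> where "\<mu> = \<alpha> + \<beta>" "\<alpha> \<in> keys f" "\<beta> \<in> keys g" using \<open>\<mu> \<in> keys (f * g)\<close> keys_mult[of f g] by blast
    then show ?thesis using f g keys_add[of \<alpha> \<beta>] unfolding diff_polys_def by blast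
  qed
  then show ?thesis using f g by (auto simp: diff_polys_alt zero_closed with_coeffs_mult)
qed

lemma diff_polys_coeff_poly: "a \<in> S \<Longrightarrow> coeff_poly a \<in> diff_polys S"
  by (auto simp: coeff_poly_def diff_polys_def keys_single)

lemma diff_polys_differential: "a \<in> S \<Longrightarrow> differential a \<in> diff_polys S"
  by (auto simp: differential_def diff_polys_def keys_single one_closed)

lemma homogeneous_add:
  "f \<in> homogeneous_diff_polys m S \<Longrightarrow> g \<in> homogeneous_diff_polys m S \<Longrightarrow> f + g \<in> homogeneous_diff_polys m S"
  using keys_add[of f g] by (auto simp: homogeneous_alt diff_polys_add)

lemma homogeneous_diff:
  "f \<in> homogeneous_diff_polys m S \<Longrightarrow> g \<in> homogeneous_diff_polys m S \<Longrightarrow> f - g \<in> homogeneous_diff_polys m S"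
  using keys_diff[of f g] by (auto simp: homogeneous_alt diff_polys_diff)

lemma homogeneous_mult:
  assumes "f \<in> homogeneous_diff_polys m S" "g \<in> homogeneous_diff_polys n S"
  shows "f * g \<in> homogeneous_diff_polys (m + n) S"
proof -
  have "pdeg \<mu> = m + n" if "\<mu> \<in> keys (f * g)" for \<mu>
  proof -
    obtain \<alpha> \<beta> where "\<mu> = \<alpha> + \<beta>" "\<alpha> \<in> keys f" "\<beta> \<in> keys g"
      using \<open>\<mu> \<in> keys (f * g)\<close> keys_mult[of f g] by blast
    then show ?thesis using assms by (auto simp: homogeneous_alt pdeg_add)
  qed
  then show ?thesis using assms by (auto simp: homogeneous_alt diff_polys_mult)
qed

lemma homogeneous_coeff_poly: "a \<in> S \<Longrightarrow> coeff_poly a \<in> homogeneous_diff_polys 0 S"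
  by (auto simp: homogeneous_alt diff_polys_coeff_poly) (auto simp: coeff_poly_def pdeg_def keys_single split: if_splits)

lemma homogeneous_differential: "a \<in> S \<Longrightarrow> differential a \<in> homogeneous_diff_polys 1 S"
  by (auto simp: homogeneous_alt diff_polys_differential)
    (auto simp: differential_def pdeg_single keys_single split: if_splits)

lemma homogeneous_power: "f \<in> homogeneous_diff_polys m S \<Longrightarrow> f ^ n \<in> homogeneous_diff_polys (n * m) S"
  using homogeneous_coeff_poly[OF one_closed]
  by (induction n) (auto simp: coeff_poly_def intro: homogeneous_mult)

lemma homogeneous_sum:
  "(\<And>x. x \<in> A \<Longrightarrow> f x \<in> homogeneous_diff_polys m S) \<Longrightarrow> sum f A \<in> homogeneous_diff_polys m S"
  by (induction A rule: infinite_finite_induct)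
    (auto intro: homogeneous_add homogeneous_zero)

lemma ideal_zero: "0 \<in> kaehler_ideal S"
proof -
  have "0 \<in> diff_polys S" by (simp add: diff_polys_def)
  from kaehler_ideal.mult[OF this kaehler_ideal.d_const] show ?thesis by simp
qed

text \<open>The inductive rules contain no negation; it is obtained from multiplication by the
  constant polynomial -1.\<close>

lemma ideal_diff: "f \<in> kaehler_ideal S \<Longrightarrow> g \<in> kaehler_ideal S \<Longrightarrow> f - g \<in> kaehler_ideal S"
proof -
  assume f: "f \<in> kaehler_ideal S" and g: "g \<in> kaehler_ideal S"
  have "coeff_poly (- 1) * g \<in> kaehler_ideal S"
    by (intro kaehler_ideal.mult diff_polys_coeff_poly uminus_closed one_closed g)
  from kaehler_ideal.add[OF f this] show ?thesis
    by (simp add: coeff_poly_def single_uminus)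
qed

end

lemma coeff_poly_hom:
  "coeff_poly (a + b) = coeff_poly a + coeff_poly b" "coeff_poly (a * b) = coeff_poly a * coeff_poly b"
  "coeff_poly 0 = 0" "coeff_poly 1 = 1" "coeff_poly (- a) = - coeff_poly a"
  by (simp_all add: coeff_poly_def single_add mult_single single_uminus)

lemma differential_power: "differential a ^ n = single (single a n) 1"
  by (induction n) (simp_all add: differential_def mult_single flip: single_add)

lemma lookup_mult_single:
  fixes f :: "'a::ab_group_add \<Rightarrow>\<^sub>0 'b::comm_ring_1"
  shows "lookup (f * single u p) x = lookup f (x - u) * p"
proof (induction f rule: poly_mapping_sum_induct)
  case (single k)
  show ?case by (auto simp: mult_single lookup_single when_def algebra_simps)
qed (simp_all add: lookup_add algebra_simps)

lemma single_power:
  "(single u p :: form) ^ n = single (int n * fst u, int n * snd u) (p ^ n)"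
  by (induction n) (auto simp: mult_single algebra_simps plus_prod_def simp flip: single_one zero_prod_def)

text \<open>At T = 0 every term with a factor \<open>B\<close> vanishes, which isolates
  \<open>c 0\<close>; then one factor \<open>B\<close> cancels and induction applies to the
  remaining coefficients.\<close>

lemma binary_form_independent:
  fixes A B :: "complex poly"
  assumes "poly A 0 \<noteq> 0" "poly B 0 = 0" "B \<noteq> 0"
    and "(\<Sum>k\<le>m. smult (c k) (A ^ (m - k) * B ^ k)) = 0" "k \<le> m"
  shows "c k = 0"
  using assms(4,5)
proof (induction m arbitrary: c k)
  case 0
  then show ?case by simp
next
  case (Suc m)
  have split: "(\<Sum>k\<le>Suc m. smult (c k) (A ^ (Suc m - k) * B ^ k)) =
      smult (c 0) (A ^ Suc m) + B * (\<Sum>k\<le>m. smult (c (Suc k)) (A ^ (m - k) * B ^ k))"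
    by (simp add: sum.atMost_Suc_shift sum_distrib_left mult_ac del: sum.atMost_Suc)
  have "poly (smult (c 0) (A ^ Suc m)) 0 = 0"
    using arg_cong[OF Suc.prems(1), of "\<lambda>p. poly p 0"] assms(2) unfolding split by simp
  then have c0: "c 0 = 0" using assms(1) by simp
  then have "(\<Sum>k\<le>m. smult (c (Suc k)) (A ^ (m - k) * B ^ k)) = 0"
    using Suc.prems(1) assms(3) unfolding split by simp
  then show ?case
    using Suc.IH[of "\<lambda>k. c (Suc k)"] c0 Suc.prems(2) by (cases k) auto
qed

text \<open>A chart has the coordinates \<open>mon v\<close> and \<open>mon w\<close>, the second
  being a power of t. The assumptions make \<open>lin v\<close> nonzero at T = 0 and
  \<open>lin w\<close> a nonzero multiple of T, as \<open>binary_form_independent\<close>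
  requires.\<close>

locale chart =
  fixes v w :: weight and bv bw :: bool
  assumes v: "fst v \<noteq> 0" and w: "fst w = 0" "snd w \<noteq> 0"
begin

abbreviation S :: "funfield set" where
  "S \<equiv> subalgebra_gen (chart_gens v w bv bw)"

abbreviation I :: "diff_poly set" where
  "I \<equiv> kaehler_ideal S"

lemma subring: "subring_set S"
  by (rule subring_set_subalgebra_gen)

lemma S_laurent: "S \<subseteq> monring UNIV"
  unfolding chart_ring by (rule monring_mono) simp

definition nterm :: "funfield \<Rightarrow> nat \<Rightarrow> nat \<Rightarrow> diff_poly" where
  "nterm s i j = coeff_poly s * differential (mon v) ^ i * differential (mon w) ^ j"

text \<open>The general element of the free \<open>S\<close>-module on the degree \<open>m\<close>
  products of the two coordinate differentials. It serves as normal form for elements of the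
  symmetric power.\<close>

definition nform :: "(nat \<Rightarrow> funfield) \<Rightarrow> nat \<Rightarrow> diff_poly" where
  "nform s m = (\<Sum>k\<le>m. nterm (s k) (m - k) k)"

definition reducible :: "nat \<Rightarrow> diff_poly set" where
  "reducible m = {f \<in> diff_polys S. \<exists>s. (\<forall>k. s k \<in> S) \<and> f - nform s m \<in> I}"

lemma mon_in_S: "mon v \<in> S" "mon w \<in> S"
  by (auto intro: subalgebra_gen.gen simp: chart_gens_def)

lemma nterm_homogeneous: "s \<in> S \<Longrightarrow> nterm s i j \<in> homogeneous_diff_polys (i + j) S"
proof -
  assume "s \<in> S"
  then have "nterm s i j \<in> homogeneous_diff_polys (0 + i * 1 + j * 1) S"
    unfolding nterm_def
    by (intro homogeneous_mult homogeneous_coeff_poly homogeneous_power homogeneous_differential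
        subring mon_in_S)
  then show ?thesis by simp
qed

lemma nform_homogeneous:
  assumes "\<And>k. s k \<in> S"
  shows "nform s m \<in> homogeneous_diff_polys m S"
  unfolding nform_def
proof (rule homogeneous_sum[OF subring])
  show "nterm (s k) (m - k) k \<in> homogeneous_diff_polys m S" if "k \<in> {..m}" for k
    using nterm_homogeneous[OF assms, of k "m - k" k] that by simp
qed

lemma homogeneous_diff_polysD: "f \<in> homogeneous_diff_polys m S \<Longrightarrow> f \<in> diff_polys S"
  by (simp add: homogeneous_diff_polys_def)

text \<open>Since d(g h) = d 1 vanishes, the Leibniz rule gives g dh + h dg = 0 modulo the ideal,
  and multiplication by \<open>h\<close> isolates dh.\<close>

lemma differential_inverse:
  assumes "g \<in> S" "h \<in> S" "g * h = 1"
  shows "differential h + coeff_poly (h * h) * differential g \<in> I"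
proof -
  have "differential (g * h) \<in> I"
    using kaehler_ideal.d_const[of 1 S] assms(3) by simp
  from ideal_diff[OF subring this kaehler_ideal.d_mult[OF assms(1,2)]]
  have "coeff_poly g * differential h + coeff_poly h * differential g \<in> I" by simp
  from kaehler_ideal.mult[OF diff_polys_coeff_poly[OF subring assms(2)] this]
  have "coeff_poly (g * h) * differential h + coeff_poly (h * h) * differential g \<in> I"
    by (simp add: coeff_poly_hom algebra_simps)
  then show ?thesis using assms(3) by (simp add: coeff_poly_hom)
qed

text \<open>The coordinate differentials generate the module of differentials: inverted coordinates
  are covered by \<open>differential_inverse\<close>, sums and products by the defining
  relations.\<close>

lemma differential_reduce:
  assumes "a \<in> S"
  shows "\<exists>\<alpha>\<in>S. \<exists>\<beta>\<in>S. differential a -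
    (coeff_poly \<alpha> * differential (mon v) + coeff_poly \<beta> * differential (mon w)) \<in> I"
  using assms
proof induction
  case (gen a)
  have inv: "inverse (mon u) \<in> S \<Longrightarrow> mon u \<in> S \<Longrightarrow>
      differential (inverse (mon u)) - coeff_poly (- (inverse (mon u) * inverse (mon u))) * differential (mon u) \<in> I"
    for u using differential_inverse[of "mon u" "inverse (mon u)"] by (simp add: coeff_poly_hom)
  from gen consider "a = mon v" | "a = mon w" | "bv" "a = inverse (mon v)" | "bw" "a = inverse (mon w)"
    by (auto simp: chart_gens_def split: if_splits)
  then show ?case
  proof cases
    case 1
    then show ?thesis
      by (intro bexI[of _ 1] bexI[of _ 0])
        (auto simp: coeff_poly_hom ideal_zero[OF subring] subalgebra_gen_zero subalgebra_gen_one)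
  next
    case 2
    then show ?thesis
      by (intro bexI[of _ 0] bexI[of _ 1])
        (auto simp: coeff_poly_hom ideal_zero[OF subring] subalgebra_gen_zero subalgebra_gen_one)
  next
    case 3
    have "a \<in> S" using gen by (rule subalgebra_gen.gen)
    then show ?thesis
      using inv[of v] 3 mon_in_S
      by (intro bexI[of _ "- (a * a)"] bexI[of _ 0])
        (auto simp: coeff_poly_hom intro: subalgebra_gen_zero subalgebra_gen_uminus subalgebra_gen.mult)
  next
    case 4
    have "a \<in> S" using gen by (rule subalgebra_gen.gen)
    then show ?thesis
      using inv[of w] 4 mon_in_S
      by (intro bexI[of _ 0] bexI[of _ "- (a * a)"])
        (auto simp: coeff_poly_hom intro: subalgebra_gen_zero subalgebra_gen_uminus subalgebra_gen.mult)
  qed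
next
  case (const c)
  then show ?case
    using kaehler_ideal.d_const[of c S]
    by (intro bexI[of _ 0]) (auto simp: coeff_poly_hom subalgebra_gen_zero)
next
  case (add a b)
  let ?d = "\<lambda>a \<alpha> \<beta>. differential a -
    (coeff_poly \<alpha> * differential (mon v) + coeff_poly \<beta> * differential (mon w))"
  from add.IH obtain \<alpha> \<beta> \<gamma> \<delta> where r: "\<alpha> \<in> S" "\<beta> \<in> S" "?d a \<alpha> \<beta> \<in> I" "\<gamma> \<in> S" "\<delta> \<in> S" "?d b \<gamma> \<delta> \<in> I"
    by blast
  from kaehler_ideal.add[OF kaehler_ideal.d_add[OF add.hyps] kaehler_ideal.add[OF r(3,6)]]
  have "?d (a + b) (\<alpha> + \<gamma>) (\<beta> + \<delta>) \<in> I" by (simp add: coeff_poly_hom algebra_simps)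
  then show ?case using r by (auto intro: subalgebra_gen.add)
next
  case (mult a b)
  let ?d = "\<lambda>a \<alpha> \<beta>. differential a -
    (coeff_poly \<alpha> * differential (mon v) + coeff_poly \<beta> * differential (mon w))"
  from mult.IH obtain \<alpha> \<beta> \<gamma> \<delta> where r: "\<alpha> \<in> S" "\<beta> \<in> S" "?d a \<alpha> \<beta> \<in> I" "\<gamma> \<in> S" "\<delta> \<in> S" "?d b \<gamma> \<delta> \<in> I"
    by blast
  have "coeff_poly b * ?d a \<alpha> \<beta> \<in> I" "coeff_poly a * ?d b \<gamma> \<delta> \<in> I"
    by (intro kaehler_ideal.mult r diff_polys_coeff_poly subring mult.hyps)+
  from kaehler_ideal.add[OF kaehler_ideal.d_mult[OF mult.hyps] kaehler_ideal.add[OF this]]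
  have "?d (a * b) (b * \<alpha> + a * \<gamma>) (b * \<beta> + a * \<delta>) \<in> I" by (simp add: coeff_poly_hom algebra_simps)
  then show ?case using r mult.hyps by (auto intro!: subalgebra_gen.add subalgebra_gen.mult)
qed

lemma nform_add: "nform (\<lambda>k. s k + r k) m = nform s m + nform r m"
  by (simp add: nform_def nterm_def coeff_poly_hom distrib_right sum.distrib)

lemma reducible_cong:
  assumes "f \<in> diff_polys S" "g \<in> reducible m" "f - g \<in> I"
  shows "f \<in> reducible m"
proof -
  from assms(2) obtain s where "\<forall>k. s k \<in> S" "g - nform s m \<in> I" by (auto simp: reducible_def)
  with kaehler_ideal.add[OF assms(3), of "g - nform s m"] assms(1) show ?thesis
    by (auto simp: reducible_def)
qed

lemma reducible_add:
  assumes "f \<in> reducible m" "g \<in> reducible m"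
  shows "f + g \<in> reducible m"
proof -
  from assms obtain s r where s: "\<forall>k. s k \<in> S" "f - nform s m \<in> I"
    and r: "\<forall>k. r k \<in> S" "g - nform r m \<in> I" by (auto simp: reducible_def)
  have "f + g - nform (\<lambda>k. s k + r k) m \<in> I"
    using kaehler_ideal.add[OF s(2) r(2)] by (simp add: nform_add algebra_simps)
  moreover have "f + g \<in> diff_polys S"
    using assms by (auto simp: reducible_def intro: diff_polys_add subring)
  ultimately show ?thesis
    using s r by (auto simp: reducible_def intro!: exI[of _ "\<lambda>k. s k + r k"] subalgebra_gen.add)
qed

lemma reducible_nterm: "s \<in> S \<Longrightarrow> nterm s i j \<in> reducible (i + j)"
proof -
  assume s: "s \<in> S"
  have "nform (\<lambda>k. if k = j then s else 0) (i + j) = (\<Sum>k\<le>i + j. if k = j then nterm s i j else 0)"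
    unfolding nform_def by (rule sum.cong) (auto simp: nterm_def coeff_poly_hom)
  also have "\<dots> = nterm s i j" by simp
  finally show ?thesis
    using s homogeneous_diff_polysD[OF nterm_homogeneous[OF s]]
    by (auto simp: reducible_def subalgebra_gen_zero ideal_zero[OF subring]
        intro!: exI[of _ "\<lambda>k. if k = j then s else 0"])
qed

lemma nterm_mult: "nterm s i j * nterm r k l = nterm (s * r) (i + k) (j + l)"
  by (simp add: nterm_def coeff_poly_hom power_add mult_ac)

lemma reducible_zero: "0 \<in> reducible m"
proof -
  have "nform (\<lambda>_. 0) m = 0" by (simp add: nform_def nterm_def coeff_poly_hom)
  then show ?thesis
    by (auto simp: reducible_def subalgebra_gen_zero ideal_zero[OF subring] diff_polys_zero[OF subring]
        intro!: exI[of _ "\<lambda>_. 0"])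
qed

lemma reducible_sum: "(\<And>x. x \<in> A \<Longrightarrow> f x \<in> reducible m) \<Longrightarrow> sum f A \<in> reducible m"
  by (induction A rule: infinite_finite_induct) (auto intro: reducible_zero reducible_add)

lemma reducible_mult:
  assumes f: "f \<in> reducible m" and g: "g \<in> reducible n"
  shows "f * g \<in> reducible (m + n)"
proof -
  from f g obtain s r where s: "\<forall>k. s k \<in> S" "f - nform s m \<in> I"
    and r: "\<forall>k. r k \<in> S" "g - nform r n \<in> I" by (auto simp: reducible_def)
  have fd: "f \<in> diff_polys S" "g \<in> diff_polys S" using f g by (auto simp: reducible_def)
  then have fg: "f * g \<in> diff_polys S" by (rule diff_polys_mult[OF subring])
  have "nterm (s k * r l) ((m - k) + (n - l)) (k + l) \<in> reducible (m + n)" if "k \<le> m" "l \<le> n" for k l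
    using reducible_nterm[of "s k * r l" "(m - k) + (n - l)" "k + l"] that s r
    by (simp add: subalgebra_gen.mult)
  then have red: "nform s m * nform r n \<in> reducible (m + n)"
    by (auto simp: nform_def sum_product nterm_mult intro!: reducible_sum)
  have "nform r n \<in> diff_polys S"
    by (rule homogeneous_diff_polysD[OF nform_homogeneous]) (use r in simp)
  \<comment> \<open>With normal forms F of f and G of g, this uses f g - F G = G (f - F) + f (g -
    G).\<close>
  from kaehler_ideal.add[OF kaehler_ideal.mult[OF this s(2)] kaehler_ideal.mult[OF fd(1) r(2)]]
  have "f * g - nform s m * nform r n \<in> I" by (simp add: algebra_simps)
  with fg red show ?thesis by (rule reducible_cong)
qed

lemma reducible_coeff_poly: "s \<in> S \<Longrightarrow> coeff_poly s \<in> reducible 0"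
  using reducible_nterm[of s 0 0] by (simp add: nterm_def)

lemma reducible_differential:
  assumes a: "a \<in> S"
  shows "differential a \<in> reducible 1"
proof -
  from differential_reduce[OF a] obtain \<alpha> \<beta> where r: "\<alpha> \<in> S" "\<beta> \<in> S"
    "differential a - (nterm \<alpha> 1 0 + nterm \<beta> 0 1) \<in> I" by (auto simp: nterm_def)
  show ?thesis
    by (rule reducible_cong[OF diff_polys_differential[OF subring a] _ r(3)])
      (use reducible_nterm[OF r(1), of 1 0] reducible_nterm[OF r(2), of 0 1] in \<open>auto intro: reducible_add\<close>)
qed

lemma reducible_power: "f \<in> reducible m \<Longrightarrow> f ^ n \<in> reducible (n * m)"
  using reducible_coeff_poly[OF subalgebra_gen_one]
  by (induction n) (auto simp: coeff_poly_hom intro: reducible_mult)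

lemma homogeneous_reducible:
  assumes f: "f \<in> homogeneous_diff_polys m S"
  shows "f \<in> reducible m"
proof -
  have mono: "single \<mu> 1 \<in> reducible (pdeg \<mu>)" if "keys \<mu> \<subseteq> S" for \<mu>
  proof (induction \<mu> rule: poly_mapping_sum_induct)
    case zero
    show ?case using reducible_coeff_poly[OF subalgebra_gen_one] by (simp add: coeff_poly_def pdeg_def)
  next
    case (single a)
    then show ?case
      using reducible_power[OF reducible_differential, of a "lookup \<mu> a"] that
      by (auto simp: differential_power pdeg_single)
  next
    case (add \<alpha> \<beta>)
    then show ?case using reducible_mult[OF add] by (simp add: mult_single pdeg_add)
  qed
  have "single \<mu> (lookup f \<mu>) \<in> reducible m" if \<mu>: "\<mu> \<in> keys f" for \<mu>
  proof -
    have "coeff_poly (lookup f \<mu>) * single \<mu> 1 \<in> reducible (0 + pdeg \<mu>)"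
      using f \<mu> by (intro reducible_mult reducible_coeff_poly mono) (auto simp: homogeneous_diff_polys_def diff_polys_def)
    then show ?thesis using f \<mu> by (auto simp: coeff_poly_def mult_single homogeneous_alt)
  qed
  then have "(\<Sum>\<mu>\<in>keys f. single \<mu> (lookup f \<mu>)) \<in> reducible m" by (rule reducible_sum)
  then show ?thesis by (simp add: sum_single_lookup)
qed

section \<open>Kernel and image of the evaluation on one chart\<close>

lemma homogeneous_laurent: "f \<in> homogeneous_diff_polys m S \<Longrightarrow> f \<in> with_coeffs (monring UNIV)"
  using diff_polys_with_coeffs[OF homogeneous_diff_polysD S_laurent laurent.zero_closed] .

lemma Ev_nterm:
  assumes "s \<in> S"
  shows "Ev.eval (nterm s i j) = \<kappa> s * single (comb v w (int i) (int j)) (lin v ^ i * lin w ^ j)"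
proof -
  have one: "1 \<in> with_coeffs (monring UNIV)"
    using laurent.with_coeffs_single[OF laurent.one_closed, of 0] by simp
  have pw: "differential u ^ n \<in> with_coeffs (monring UNIV) \<and>
      Ev.eval (differential u ^ n) = D (\<kappa> u) ^ n" for u n
    by (induction n) (auto simp: Ev.eval_mult Ev.eval_one Ev_differential differential_in
        laurent.with_coeffs_mult one)
  have "coeff_poly s \<in> with_coeffs (monring UNIV)"
    using assms S_laurent by (auto intro: coeff_poly_in)
  then have "Ev.eval (nterm s i j) = \<kappa> s * (D (\<kappa> (mon v)) ^ i * D (\<kappa> (mon w)) ^ j)"
    by (simp add: nterm_def Ev.eval_mult laurent.with_coeffs_mult pw Ev_coeff_poly mult.assoc)
  also have "D (\<kappa> (mon v)) ^ i * D (\<kappa> (mon w)) ^ j =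
      single (comb v w (int i) (int j)) (lin v ^ i * lin w ^ j)"
    by (simp add: \<kappa>_mon D_single single_power mult_single comb_def)
  finally show ?thesis .
qed

text \<open>The weight of (d v)^(m-k) (d w)^k: passing to logarithmic differentials, each factor d v
  = v (dv/v) contributes the weight of the coordinate itself.\<close>

definition wt :: "nat \<Rightarrow> nat \<Rightarrow> weight" where
  "wt m k = comb v w (int (m - k)) (int k)"

lemma lookup_Ev_nform:
  assumes s: "\<And>k. s k \<in> S"
  shows "lookup (Ev.eval (nform s m)) u =
    (\<Sum>k\<le>m. smult (coeff (lookup (\<kappa> (s k)) (u - wt m k)) 0) (lin v ^ (m - k) * lin w ^ k))"
proof -
  have "nterm (s k) (m - k) k \<in> with_coeffs (monring UNIV)" for k
    by (rule homogeneous_laurent[OF nterm_homogeneous[OF s]])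
  then have "Ev.eval (nform s m) = (\<Sum>k\<le>m. \<kappa> (s k) * single (wt m k) (lin v ^ (m - k) * lin w ^ k))"
    by (simp add: nform_def Ev.eval_sum Ev_nterm s wt_def)
  moreover have "lookup (\<kappa> (s k)) x * q = smult (coeff (lookup (\<kappa> (s k)) x) 0) q" for k x q
  proof -
    have "\<kappa> (s k) \<in> scalar_forms" using monringD(1) s S_laurent by blast
    then obtain a where "lookup (\<kappa> (s k)) x = [:a:]" by (blast dest: scalar_form_lookup)
    then show ?thesis by simp
  qed
  ultimately show ?thesis by (simp add: lookup_sum lookup_mult_single)
qed

lemma lin_vw: "poly (lin v) 0 \<noteq> 0" "poly (lin w) 0 = 0" "lin w \<noteq> 0"
  using v w by (auto simp: lin_def)

lemma nform_injective:
  assumes s: "\<And>k. s k \<in> S" and 0: "Ev.eval (nform s m) = 0" and k: "k \<le> m"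
  shows "s k = 0"
proof -
  have sk: "s k \<in> monring UNIV" using s S_laurent by blast
  have "\<kappa> (s k) = 0"
  proof (rule poly_mapping_eqI)
    fix x
    \<comment> \<open>The weight \<open>x + wt m k\<close> is chosen so that the \<open>k\<close>-th
      coefficient is that of \<open>s k\<close> at \<open>x\<close>.\<close>
    have "(\<Sum>l\<le>m. smult (coeff (lookup (\<kappa> (s l)) (x + wt m k - wt m l)) 0)
        (lin v ^ (m - l) * lin w ^ l)) = 0"
      using lookup_Ev_nform[of s m "x + wt m k", OF s] 0 by simp
    from binary_form_independent[OF lin_vw this k]
    have "coeff (lookup (\<kappa> (s k)) x) 0 = 0" by simp
    then show "lookup (\<kappa> (s k)) x = lookup 0 x"
      using scalar_form_lookup[OF monringD(1)[OF sk], of x] by simp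
  qed
  then show ?thesis using monringD(3)[OF sk] by simp
qed

text \<open>The evaluation does not distinguish \<open>f\<close> from its normal form modulo the
  ideal, and a normal form that evaluates to zero is zero.\<close>

lemma Ev_kernel:
  assumes f: "f \<in> homogeneous_diff_polys m S" and 0: "Ev.eval f = 0"
  shows "f \<in> I"
proof -
  from homogeneous_reducible[OF f] obtain s where s: "\<And>k. s k \<in> S" "f - nform s m \<in> I"
    by (auto simp: reducible_def)
  have nl: "nform s m \<in> with_coeffs (monring UNIV)"
    by (rule homogeneous_laurent[OF nform_homogeneous[OF s(1)]])
  have "Ev.eval (f - nform s m) = 0" using Ev_kaehler_ideal[OF s(2) S_laurent] by simp
  then have "Ev.eval (nform s m) = 0"
    using 0 by (simp add: Ev.eval_diff homogeneous_laurent[OF f] nl)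
  from nform_injective[OF s(1) this] have "nform s m = 0"
    by (simp add: nform_def nterm_def coeff_poly_hom)
  then show ?thesis using s(2) by simp
qed

text \<open>Here \<open>c k\<close> multiplies the monomial of weight \<open>u - wt m k\<close> in
  front of (d v)^(m-k) (d w)^k; it may be nonzero only if that monomial is regular on the
  chart.\<close>

definition admissible :: "nat \<Rightarrow> weight \<Rightarrow> complex poly \<Rightarrow> bool" where
  "admissible m u p \<longleftrightarrow> (\<exists>c. (\<forall>k\<le>m. c k \<noteq> 0 \<longrightarrow> u - wt m k \<in> chart_cone v w bv bw) \<and>
     p = (\<Sum>k\<le>m. smult (c k) (lin v ^ (m - k) * lin w ^ k)))"

lemma Ev_image:
  "F \<in> Ev.eval ` homogeneous_diff_polys m S \<longleftrightarrow> (\<forall>u. admissible m u (lookup F u))"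
proof
  assume "F \<in> Ev.eval ` homogeneous_diff_polys m S"
  then obtain f where f: "f \<in> homogeneous_diff_polys m S" "F = Ev.eval f" by auto
  from homogeneous_reducible[OF f(1)] obtain s where s: "\<And>k. s k \<in> S" "f - nform s m \<in> I"
    by (auto simp: reducible_def)
  have nl: "nform s m \<in> with_coeffs (monring UNIV)"
    by (rule homogeneous_laurent[OF nform_homogeneous[OF s(1)]])
  have "Ev.eval (f - nform s m) = 0" using Ev_kaehler_ideal[OF s(2) S_laurent] by simp
  then have F: "F = Ev.eval (nform s m)"
    using f by (simp add: Ev.eval_diff homogeneous_laurent nl)
  have supp: "u - wt m k \<in> chart_cone v w bv bw" if "coeff (lookup (\<kappa> (s k)) (u - wt m k)) 0 \<noteq> 0" for u k
    using monringD(2)[OF s(1)[of k, unfolded chart_ring]] that by (metis coeff_0 in_keys_iff subsetD)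
  show "\<forall>u. admissible m u (lookup F u)"
    unfolding admissible_def F lookup_Ev_nform[OF s(1)]
    by (intro allI exI conjI impI, rule supp) (assumption, rule refl)
next
  assume "\<forall>u. admissible m u (lookup F u)"
  then obtain c where c: "\<And>u k. k \<le> m \<Longrightarrow> c u k \<noteq> 0 \<Longrightarrow> u - wt m k \<in> chart_cone v w bv bw"
    "\<And>u. lookup F u = (\<Sum>k\<le>m. smult (c u k) (lin v ^ (m - k) * lin w ^ k))"
    unfolding admissible_def by metis
  \<comment> \<open>The \<open>k\<close>-th coefficient function, assembled over all weights of
    \<open>F\<close>. For \<open>k > m\<close> nothing is known about \<open>c u k\<close>, but
    \<open>nform_homogeneous\<close> wants every coefficient in \<open>S\<close>, hence the default
    0.\<close>
  define f where "f k = (if k \<le> m then \<Sum>u\<in>keys F. single (u - wt m k) [:c u k:] else 0)" for k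
  have fs: "f k \<in> scalar_forms" for k
    unfolding f_def scalar_forms_def
    by (auto intro!: scalar.with_coeffs_sum scalar.with_coeffs_single scalar.with_coeffs_zero)
  have "keys (f k) \<subseteq> chart_cone v w bv bw" for k
    unfolding f_def using c(1)[of k] by (auto dest!: keys_sum[THEN subsetD] simp: keys_single split: if_splits)
  then have s: "toK.eval (f k) \<in> S" for k
    unfolding chart_ring by (rule monringI[OF fs])
  have lookf: "coeff (lookup (f k) (u - wt m k)) 0 = (if u \<in> keys F then c u k else 0)" if "k \<le> m" for u k
    using that by (simp add: f_def lookup_sum lookup_single when_def coeff_sum if_distrib[of "\<lambda>p. coeff p 0"] cong: if_cong)
  have "F = Ev.eval (nform (\<lambda>k. toK.eval (f k)) m)"
  proof (rule poly_mapping_eqI)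
    fix u
    show "lookup F u = lookup (Ev.eval (nform (\<lambda>k. toK.eval (f k)) m)) u"
    proof (cases "u \<in> keys F")
      case True
      then show ?thesis
        unfolding lookup_Ev_nform[OF s] \<kappa>_eval[OF fs] by (simp add: lookf c(2))
    next
      case False
      then show ?thesis
        unfolding lookup_Ev_nform[OF s] \<kappa>_eval[OF fs] by (simp add: lookf in_keys_iff)
    qed
  qed
  then show "F \<in> Ev.eval ` homogeneous_diff_polys m S"
    by (rule image_eqI) (rule nform_homogeneous[OF s])
qed

end

section \<open>The charts of the blow-up\<close>

text \<open>The charts have coordinates x, t for \<open>I1\<close>; x, t with t invertible for
  \<open>I2\<close>; and x t^2, 1/t for \<open>I3\<close>. In each of them
  \<open>mon (chart_v i)\<close> is an equation of E.\<close>

fun chart_v :: "idx \<Rightarrow> weight" where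
  "chart_v I1 = (1, 0)" | "chart_v I2 = (1, 0)" | "chart_v I3 = (1, 2)"

fun chart_w :: "idx \<Rightarrow> weight" where
  "chart_w I1 = (0, 1)" | "chart_w I2 = (0, 1)" | "chart_w I3 = (0, - 1)"

text \<open>The flag tells whether the equation of \<open>E\<close> is inverted.\<close>

definition chart_alg :: "bool \<Rightarrow> idx \<Rightarrow> funfield set" where
  "chart_alg b i = subalgebra_gen (chart_gens (chart_v i) (chart_w i) b (i = I2))"

fun coord_weight :: "idx \<Rightarrow> weight" where
  "coord_weight I1 = (1, 0)" | "coord_weight I2 = (1, 1)" | "coord_weight I3 = (1, 2)"

lemma coord_mon: "coord i = mon (coord_weight i)"
  by (cases i) (auto simp: mon_def power_int_minus divide_inverse mult.commute)

lemma mon_diff: "mon (x - y) = mon x / mon y"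
  using mon_add[of "x - y" y] by (simp add: field_simps)

lemma chart_cone_xt: "chart_cone (1, 0) (0, 1) b c = {u. (b \<or> 0 \<le> fst u) \<and> (c \<or> 0 \<le> snd u)}"
  by (auto simp: chart_cone_def comb_def)

lemma chart_cone_yt:
  "chart_cone (1, 2) (0, - 1) b c = {u. (b \<or> 0 \<le> fst u) \<and> (c \<or> snd u \<le> 2 * fst u)}"
proof -
  have "\<exists>i j. u = comb (1, 2) (0, - 1) i j \<and> (b \<or> 0 \<le> i) \<and> (c \<or> 0 \<le> j)"
    if "b \<or> 0 \<le> fst u" "c \<or> snd u \<le> 2 * fst u" for u
    using that by (intro exI[of _ "fst u"] exI[of _ "2 * fst u - snd u"]) (auto simp: comb_def prod_eq_iff)
  then show ?thesis by (auto simp: chart_cone_def comb_def)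
qed

lemma mon_in_chart_algI:
  "(case i of I1 \<Rightarrow> (b \<or> 0 \<le> fst u) \<and> 0 \<le> snd u | I2 \<Rightarrow> b \<or> 0 \<le> fst u
     | I3 \<Rightarrow> (b \<or> 0 \<le> fst u) \<and> snd u \<le> 2 * fst u) \<Longrightarrow> mon u \<in> chart_alg b i"
  unfolding chart_alg_def chart_ring
  by (rule mon_in_monring) (cases i; simp add: chart_cone_xt chart_cone_yt)

lemma chart_alg_mono: "chart_alg False i \<subseteq> chart_alg True i"
  unfolding chart_alg_def chart_ring
  by (rule monring_mono) (cases i; auto simp: chart_cone_xt chart_cone_yt)

lemma chart_alg_I2: "chart_alg b i \<subseteq> chart_alg b I2"
  unfolding chart_alg_def chart_ring
  by (rule monring_mono) (cases i; auto simp: chart_cone_xt chart_cone_yt)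

lemma chart_alg_subset:
  assumes "mon (chart_v i) \<in> subalgebra_gen G" "mon (chart_w i) \<in> subalgebra_gen G"
    "b \<Longrightarrow> inverse (mon (chart_v i)) \<in> subalgebra_gen G"
    "i = I2 \<Longrightarrow> inverse (mon (chart_w i)) \<in> subalgebra_gen G"
  shows "chart_alg b i \<subseteq> subalgebra_gen G"
  unfolding chart_alg_def by (rule subalgebra_gen_least) (use assms in \<open>auto simp: chart_gens_def\<close>)

lemma coord_in_chart_alg: "coord j \<in> chart_alg b i"
  unfolding coord_mon by (rule mon_in_chart_algI) (cases i; cases j; simp)

lemma blowup_chart_eq: "blowup_chart i = chart_alg False i"
proof
  show "blowup_chart i \<subseteq> chart_alg False i"
    unfolding blowup_chart_def
  proof (subst chart_alg_def, rule subalgebra_gen_least, fold chart_alg_def)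
    have "cone_ring \<subseteq> chart_alg False i"
      unfolding cone_ring_def chart_alg_def
      by (rule subalgebra_gen_least) (use coord_in_chart_alg in \<open>auto simp: chart_alg_def\<close>)
    moreover have "coord j / coord i \<in> chart_alg False i" for j
      unfolding coord_mon mon_diff[symmetric]
      by (rule mon_in_chart_algI) (cases i; cases j; simp)
    ultimately show "cone_ring \<union> range (\<lambda>j. coord j / coord i) \<subseteq> chart_alg False i" by auto
  qed
  have c: "coord j \<in> blowup_chart i" for j
    unfolding blowup_chart_def cone_ring_def by (auto intro: subalgebra_gen.gen)
  have d: "mon (coord_weight j - coord_weight i) \<in> blowup_chart i" for j
    unfolding blowup_chart_def mon_diff coord_mon[symmetric] by (auto intro: subalgebra_gen.gen)
  show "chart_alg False i \<subseteq> blowup_chart i"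
    unfolding blowup_chart_def
    by (rule chart_alg_subset; fold blowup_chart_def)
      (use c[of I1] c[of I3] d[of I1] d[of I2] d[of I3]
        in \<open>cases i; simp add: coord_mon flip: mon_uminus\<close>)+
qed

lemma blowup_minus_E_chart_eq: "blowup_minus_E_chart i = chart_alg True i"
proof
  show "blowup_minus_E_chart i \<subseteq> chart_alg True i"
    unfolding blowup_minus_E_chart_def
  proof (subst chart_alg_def, rule subalgebra_gen_least, fold chart_alg_def)
    have "inverse (coord i) \<in> chart_alg True i"
      unfolding coord_mon mon_uminus[symmetric]
      by (rule mon_in_chart_algI) (cases i; simp)
    then show "blowup_chart i \<union> {inverse (coord i)} \<subseteq> chart_alg True i"
      using chart_alg_mono[of i] by (auto simp: blowup_chart_eq)
  qed
  have E: "u \<in> blowup_minus_E_chart i" if "u \<in> chart_alg False i" for u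
    using that unfolding blowup_minus_E_chart_def blowup_chart_eq by (auto intro: subalgebra_gen.gen)
  have inv: "mon (- coord_weight i) \<in> blowup_minus_E_chart i"
    unfolding blowup_minus_E_chart_def coord_mon mon_uminus by (auto intro: subalgebra_gen.gen)
  \<comment> \<open>The inverted element is \<open>coord i\<close>, not
    \<open>mon (chart_v i)\<close>. They differ only on the second chart, where x2 = x t and t is a
    unit.\<close>
  have "inverse (mon (chart_v i)) = mon (- coord_weight i) * mon (coord_weight i - chart_v i)"
    by (simp add: mon_diff mon_uminus inverse_eq_divide)
  moreover have "mon (coord_weight i - chart_v i) \<in> blowup_minus_E_chart i"
    by (rule E, rule mon_in_chart_algI) (cases i; simp)
  ultimately have "inverse (mon (chart_v i)) \<in> blowup_minus_E_chart i"
    using inv unfolding blowup_minus_E_chart_def by (simp add: subalgebra_gen.mult)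
  moreover have "mon (chart_v i) \<in> chart_alg False i" "mon (chart_w i) \<in> chart_alg False i"
    "i = I2 \<Longrightarrow> inverse (mon (chart_w i)) \<in> chart_alg False i"
    unfolding chart_alg_def by (auto intro: subalgebra_gen.gen simp: chart_gens_def)
  ultimately show "chart_alg True i \<subseteq> blowup_minus_E_chart i"
    using E unfolding blowup_minus_E_chart_def by (intro chart_alg_subset) auto
qed

text \<open>The second chart is contained in the other two, and is their intersection.\<close>

definition meet :: "idx \<Rightarrow> idx \<Rightarrow> idx" where
  "meet i j = (if i = j then i else I2)"

lemma chart_alg_meet: "chart_alg b i \<union> chart_alg b j \<subseteq> chart_alg b (meet i j)"
  using chart_alg_I2[of b i] chart_alg_I2[of b j] by (auto simp: meet_def)

lemma chart_alg_Un: "subalgebra_gen (chart_alg b i \<union> chart_alg b j) = chart_alg b (meet i j)"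
proof
  show "subalgebra_gen (chart_alg b i \<union> chart_alg b j) \<subseteq> chart_alg b (meet i j)"
    using chart_alg_meet[of b i j] unfolding chart_alg_def by (rule subalgebra_gen_least)
  have m: "mon u \<in> subalgebra_gen (chart_alg b i \<union> chart_alg b j)"
    if "mon u \<in> chart_alg b i \<or> mon u \<in> chart_alg b j" for u
    using that by (auto intro: subalgebra_gen.gen)
  show "chart_alg b (meet i j) \<subseteq> subalgebra_gen (chart_alg b i \<union> chart_alg b j)"
  proof (cases "i = j")
    case True
    then show ?thesis by (auto simp: meet_def intro: subalgebra_gen.gen)
  next
    case False
    show ?thesis
    proof (rule chart_alg_subset; (unfold mon_uminus[symmetric])?; rule m)
      show "mon (chart_v (meet i j)) \<in> chart_alg b i \<or> mon (chart_v (meet i j)) \<in> chart_alg b j"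
        using False by (cases i; cases j; simp add: meet_def mon_in_chart_algI)
      show "mon (chart_w (meet i j)) \<in> chart_alg b i \<or> mon (chart_w (meet i j)) \<in> chart_alg b j"
        using False by (cases i; cases j; simp add: meet_def mon_in_chart_algI)
      show "mon (- chart_v (meet i j)) \<in> chart_alg b i \<or> mon (- chart_v (meet i j)) \<in> chart_alg b j" if b
        using False that by (cases i; cases j; simp add: meet_def mon_in_chart_algI)
      show "mon (- chart_w (meet i j)) \<in> chart_alg b i \<or> mon (- chart_w (meet i j)) \<in> chart_alg b j"
        using False by (cases i; cases j; simp add: meet_def mon_in_chart_algI)
    qed
  qed
qed

section \<open>Global sections as forms\<close>

lemma chart_idx: "chart (chart_v i) (chart_w i)"
  by unfold_locales (cases i; simp)+

lemma chart_alg_laurent: "chart_alg b i \<subseteq> monring UNIV"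
  unfolding chart_alg_def by (rule chart.S_laurent[OF chart_idx])

lemma chart_alg_kernel:
  "f \<in> homogeneous_diff_polys m (chart_alg b i) \<Longrightarrow> Ev.eval f = 0 \<Longrightarrow> f \<in> kaehler_ideal (chart_alg b i)"
  unfolding chart_alg_def by (rule chart.Ev_kernel[OF chart_idx])

lemma chart_alg_homogeneous_laurent:
  "f \<in> homogeneous_diff_polys m (chart_alg b i) \<Longrightarrow> f \<in> with_coeffs (monring UNIV)"
  unfolding chart_alg_def by (rule chart.homogeneous_laurent[OF chart_idx])

lemma subring_chart_alg: "subring_set (chart_alg b i)"
  unfolding chart_alg_def by (rule subring_set_subalgebra_gen)

lemma homogeneous_mono: "S \<subseteq> T \<Longrightarrow> homogeneous_diff_polys m S \<subseteq> homogeneous_diff_polys m T"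
  by (auto simp: homogeneous_diff_polys_def diff_polys_def)

text \<open>The ring of each overlap is again the ring of a chart, namely \<open>meet i j\<close>,
  so \<open>chart_alg_kernel\<close> turns the gluing condition modulo the ideal into equality of
  evaluations.\<close>

lemma sym_sections_iff:
  "\<omega> \<in> sym_sections m (chart_alg b) \<longleftrightarrow>
    (\<forall>i. \<omega> i \<in> homogeneous_diff_polys m (chart_alg b i)) \<and> (\<forall>i j. Ev.eval (\<omega> i) = Ev.eval (\<omega> j))"
proof -
  have "\<omega> i - \<omega> j \<in> kaehler_ideal (chart_alg b (meet i j)) \<longleftrightarrow> Ev.eval (\<omega> i) = Ev.eval (\<omega> j)"
    if h: "\<And>i. \<omega> i \<in> homogeneous_diff_polys m (chart_alg b i)" for i j
  proof -
    have d: "Ev.eval (\<omega> i - \<omega> j) = Ev.eval (\<omega> i) - Ev.eval (\<omega> j)"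
      by (intro Ev.eval_diff chart_alg_homogeneous_laurent[OF h])
    have "\<omega> i \<in> homogeneous_diff_polys m (chart_alg b (meet i j))"
      "\<omega> j \<in> homogeneous_diff_polys m (chart_alg b (meet i j))"
      using h[of i] h[of j] homogeneous_mono[of "chart_alg b i" "chart_alg b (meet i j)" m]
        homogeneous_mono[of "chart_alg b j" "chart_alg b (meet i j)" m] chart_alg_meet[of b i j] by auto
    then have "\<omega> i - \<omega> j \<in> homogeneous_diff_polys m (chart_alg b (meet i j))"
      by (rule homogeneous_diff[OF subring_chart_alg])
    moreover have "Ev.eval (\<omega> i) = Ev.eval (\<omega> j) \<longleftrightarrow> Ev.eval (\<omega> i - \<omega> j) = 0"
      unfolding d by simp
    ultimately show ?thesis
      using chart_alg_kernel Ev_kaehler_ideal[OF _ chart_alg_laurent] by blast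
  qed
  then show ?thesis unfolding sym_sections_def chart_alg_Un by blast
qed

lemma zero_sections_iff:
  "\<omega> \<in> zero_sections m (chart_alg b) \<longleftrightarrow>
    (\<forall>i. \<omega> i \<in> homogeneous_diff_polys m (chart_alg b i) \<and> Ev.eval (\<omega> i) = 0)"
  unfolding zero_sections_def using chart_alg_kernel Ev_kaehler_ideal[OF _ chart_alg_laurent] by blast

text \<open>A concrete model of the space of global sections, over Y - E for \<open>True\<close> and
  over Y for \<open>False\<close>: a section is determined by the common value of its
  representatives.\<close>

definition global_forms :: "bool \<Rightarrow> nat \<Rightarrow> form set" where
  "global_forms b m = (\<Inter>i. Ev.eval ` homogeneous_diff_polys m (chart_alg b i))"

lemma sym_sections_onto:
  assumes "F \<in> global_forms b m"
  shows "\<exists>\<omega>\<in>sym_sections m (chart_alg b). \<forall>i. Ev.eval (\<omega> i) = F"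
proof -
  have "\<exists>f. \<forall>i. f i \<in> homogeneous_diff_polys m (chart_alg b i) \<and> Ev.eval (f i) = F"
    using assms by (intro choice) (auto simp: global_forms_def)
  then obtain f where "\<forall>i. f i \<in> homogeneous_diff_polys m (chart_alg b i) \<and> Ev.eval (f i) = F" ..
  then show ?thesis by (intro bexI[of _ f]) (simp_all add: sym_sections_iff)
qed

lemma sym_sections_eval:
  "\<omega> \<in> sym_sections m (chart_alg b) \<Longrightarrow> Ev.eval (\<omega> i) \<in> global_forms b m"
  unfolding sym_sections_iff global_forms_def by (metis INT_I image_eqI)

definition extendable :: "nat \<Rightarrow> (idx \<Rightarrow> diff_poly) set" where
  "extendable m = {\<rho> + \<zeta> | \<rho> \<zeta>. \<rho> \<in> sym_sections m (chart_alg False) \<and> \<zeta> \<in> zero_sections m (chart_alg True)}"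

text \<open>If the value of \<omega> is also the value of a section over Y, the difference of the
  two evaluates to zero and is a zero section. The index \<open>I1\<close> is arbitrary, since all
  components have the same value.\<close>

lemma extendable_iff:
  "\<omega> \<in> extendable m \<longleftrightarrow> \<omega> \<in> sym_sections m (chart_alg True) \<and> Ev.eval (\<omega> I1) \<in> global_forms False m"
proof -
  have ht: "f \<in> homogeneous_diff_polys m (chart_alg True i)"
    if "f \<in> homogeneous_diff_polys m (chart_alg False i)" for f i
    using that homogeneous_mono[OF chart_alg_mono] by blast
  show ?thesis
  proof
    assume "\<omega> \<in> extendable m"
    then obtain \<rho> \<zeta> where \<omega>: "\<omega> = \<rho> + \<zeta>" and \<rho>: "\<rho> \<in> sym_sections m (chart_alg False)"
      and \<zeta>: "\<zeta> \<in> zero_sections m (chart_alg True)" by (auto simp: extendable_def)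
    have Ev: "Ev.eval (\<omega> i) = Ev.eval (\<rho> i)" for i
    proof -
      have "Ev.eval (\<rho> i + \<zeta> i) = Ev.eval (\<rho> i) + Ev.eval (\<zeta> i)"
        using \<rho> \<zeta> by (intro Ev.eval_add chart_alg_homogeneous_laurent[of _ m])
          (auto simp: sym_sections_iff zero_sections_iff intro: ht)
      then show ?thesis using \<zeta> by (simp add: \<omega> zero_sections_iff)
    qed
    have "\<omega> \<in> sym_sections m (chart_alg True)"
      using \<rho> \<zeta> unfolding sym_sections_iff Ev
      by (auto simp: \<omega> sym_sections_iff zero_sections_iff intro!: homogeneous_add[OF subring_chart_alg] intro: ht)
    then show "\<omega> \<in> sym_sections m (chart_alg True) \<and> Ev.eval (\<omega> I1) \<in> global_forms False m"
      unfolding Ev using sym_sections_eval[OF \<rho>] by simp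
  next
    assume \<omega>: "\<omega> \<in> sym_sections m (chart_alg True) \<and> Ev.eval (\<omega> I1) \<in> global_forms False m"
    from sym_sections_onto[OF conjunct2[OF this]] obtain \<rho> where
      \<rho>: "\<rho> \<in> sym_sections m (chart_alg False)" "\<And>i. Ev.eval (\<rho> i) = Ev.eval (\<omega> I1)" by blast
    have "\<omega> - \<rho> \<in> zero_sections m (chart_alg True)"
      unfolding zero_sections_iff
    proof
      fix i
      have h: "\<omega> i \<in> homogeneous_diff_polys m (chart_alg True i)"
        "\<rho> i \<in> homogeneous_diff_polys m (chart_alg True i)"
        using \<omega> \<rho>(1) by (auto simp: sym_sections_iff intro: ht)
      have "Ev.eval (\<omega> i - \<rho> i) = Ev.eval (\<omega> i) - Ev.eval (\<rho> i)"
        by (intro Ev.eval_diff chart_alg_homogeneous_laurent[OF h(1)] chart_alg_homogeneous_laurent[OF h(2)])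
      moreover have "Ev.eval (\<omega> i) = Ev.eval (\<omega> I1)" using \<omega> by (simp add: sym_sections_iff)
      ultimately show "(\<omega> - \<rho>) i \<in> homogeneous_diff_polys m (chart_alg True i) \<and> Ev.eval ((\<omega> - \<rho>) i) = 0"
        using homogeneous_diff[OF subring_chart_alg h] \<rho>(2) by simp
    qed
    moreover have "\<omega> = \<rho> + (\<omega> - \<rho>)" by simp
    ultimately show "\<omega> \<in> extendable m" unfolding extendable_def using \<rho>(1) by blast
  qed
qed

lemma chi0_eq:
  "chi0 m = quot_dim scale_section (sym_sections m (chart_alg True)) (extendable m)"
proof -
  have "blowup_chart = chart_alg False" "blowup_minus_E_chart = chart_alg True"
    by (auto simp: blowup_chart_eq blowup_minus_E_chart_eq)
  then show ?thesis by (simp add: chi0_def extendable_def)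
qed

section \<open>Regularity conditions weight by weight\<close>

lemma global_forms_iff_admissible:
  "F \<in> global_forms b m \<longleftrightarrow>
    (\<forall>i u. chart.admissible (chart_v i) (chart_w i) b (i = I2) m u (lookup F u))"
  unfolding global_forms_def chart_alg_def by (simp add: chart.Ev_image[OF chart_idx])

text \<open>For these coordinates (lin v)^(m-k) (lin w)^k is T^k, so the coefficients
  \<open>c k\<close> are those of \<open>p\<close>.\<close>

lemma admissible_xt:
  "chart.admissible (1, 0) (0, 1) bv bw m u p \<longleftrightarrow> degree p \<le> m \<and>
    (\<forall>k. coeff p k \<noteq> 0 \<longrightarrow> (bv \<or> int m - fst u \<le> int k) \<and> (bw \<or> int k \<le> snd u))"
proof -
  interpret chart "(1, 0)" "(0, 1)" bv bw by unfold_locales auto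
  have c: "u - wt m k \<in> chart_cone (1, 0) (0, 1) bv bw \<longleftrightarrow>
      (bv \<or> int m - fst u \<le> int k) \<and> (bw \<or> int k \<le> snd u)" if "k \<le> m" for k
    using that by (simp add: wt_def comb_def chart_cone_xt of_nat_diff) linarith
  have l: "smult (c k) (lin (1, 0) ^ (m - k) * lin (0, 1) ^ k) = monom (c k) k" for c :: "nat \<Rightarrow> complex" and k
    by (simp add: lin_def monom_altdef flip: one_pCons)
  show ?thesis
  proof
    assume "admissible m u p"
    then obtain d where d: "\<And>k. k \<le> m \<Longrightarrow> d k \<noteq> 0 \<Longrightarrow> u - wt m k \<in> chart_cone (1, 0) (0, 1) bv bw"
      "p = (\<Sum>k\<le>m. monom (d k) k)"
      unfolding admissible_def l by blast
    have co: "coeff p k = (if k \<le> m then d k else 0)" for k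
      unfolding d(2) by (simp add: coeff_sum)
    have "degree p \<le> m" by (rule degree_le) (simp add: co)
    then show "degree p \<le> m \<and>
      (\<forall>k. coeff p k \<noteq> 0 \<longrightarrow> (bv \<or> int m - fst u \<le> int k) \<and> (bw \<or> int k \<le> snd u))"
      using d(1) c by (auto simp: co)
  next
    assume p: "degree p \<le> m \<and>
      (\<forall>k. coeff p k \<noteq> 0 \<longrightarrow> (bv \<or> int m - fst u \<le> int k) \<and> (bw \<or> int k \<le> snd u))"
    show "admissible m u p"
      unfolding admissible_def l
      by (rule exI[of _ "coeff p"]) (use p c in \<open>auto simp: poly_as_sum_of_monoms'\<close>)
  qed
qed

lemma coprime_forms: "coprime [:1, 2 :: complex:] (monom 1 1)"
proof (rule coprimeI)
  fix d :: "complex poly" assume "d dvd [:1, 2:]" "d dvd monom 1 1"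
  then have "d dvd [:1, 2:] - smult 2 (monom 1 1)" by (intro dvd_diff dvd_smult)
  also have "[:1, 2:] - smult 2 (monom 1 1) = (1 :: complex poly)"
    by (simp add: monom_altdef one_pCons)
  finally show "is_unit d" .
qed

lemma coprime_form_powers: "coprime ([:1, 2 :: complex:] ^ e) (monom 1 r)"
proof -
  have "coprime ([:1, 2 :: complex:] ^ e) (monom 1 1 ^ r)" using coprime_forms by simp
  then show ?thesis by (simp add: monom_power)
qed

text \<open>Subtracting h(0) (1 + 2 T)^N leaves a multiple of T, and the quotient has smaller degree
  bound. The base -T is \<open>lin\<close> of the third chart's second coordinate 1/t.\<close>

lemma binary_form_span:
  fixes h :: "complex poly"
  assumes "degree h \<le> N"
  shows "\<exists>d. h = (\<Sum>k\<le>N. smult (d k) ([:1, 2:] ^ (N - k) * [:0, - 1:] ^ k))"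
  using assms
proof (induction N arbitrary: h)
  case 0
  then obtain a where "h = [:a:]" by (auto elim: degree_eq_zeroE)
  then show ?case by (intro exI[of _ "\<lambda>_. a"]) simp
next
  case (Suc N)
  define g where "g = h - smult (poly h 0) ([:1, 2:] ^ Suc N)"
  have "degree ([:1, 2 :: complex:] ^ Suc N) \<le> Suc N"
    using degree_power_le[of "[:1, 2 :: complex:]" "Suc N"] by simp
  then have dg: "degree g \<le> Suc N"
    unfolding g_def using Suc.prems by (intro degree_diff_le order.trans[OF degree_smult_le])
  have "poly g 0 = 0" by (simp add: g_def)
  then obtain q where q: "g = [:0, 1:] * q" by (auto simp: poly_eq_0_iff_dvd)
  have "degree q \<le> N"
    using dg by (cases "q = 0") (simp_all add: q degree_mult_eq)
  from Suc.IH[of "- q"] this obtain d where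
    d: "- q = (\<Sum>k\<le>N. smult (d k) ([:1, 2:] ^ (N - k) * [:0, - 1:] ^ k))" by auto
  have "h = smult (poly h 0) ([:1, 2:] ^ Suc N) + [:0, - 1:] * (- q)"
    using q by (simp add: g_def algebra_simps)
  also have "\<dots> = (\<Sum>k\<le>Suc N. smult ((case k of 0 \<Rightarrow> poly h 0 | Suc k \<Rightarrow> d k))
      ([:1, 2:] ^ (Suc N - k) * [:0, - 1:] ^ k))"
    unfolding d sum.atMost_Suc_shift by (simp add: sum_distrib_left mult_ac del: mult_pCons_left mult_pCons_right)
  finally show ?case by blast
qed

text \<open>Bounding both exponents from below amounts to extracting the factor (-T)^r (1 + 2 T)^e.
  For the converse, coprimality of the two powers shows that their product divides \<open>p\<close>,
  and \<open>binary_form_span\<close> expands the cofactor.\<close>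

lemma binary_form_truncated:
  fixes p :: "complex poly"
  shows "(\<exists>c. (\<forall>k\<le>m. c k \<noteq> 0 \<longrightarrow> r \<le> k \<and> k + e \<le> m) \<and>
      p = (\<Sum>k\<le>m. smult (c k) ([:1, 2:] ^ (m - k) * [:0, - 1:] ^ k))) \<longleftrightarrow>
    degree p \<le> m \<and> monom 1 r dvd p \<and> [:1, 2:] ^ e dvd p"
    (is "?L \<longleftrightarrow> ?R")
proof -
  have B: "[:0, - 1 :: complex:] ^ k = smult ((- 1) ^ k) (monom 1 k)" for k
  proof -
    have "[:0, - 1 :: complex:] = smult (- 1) (monom 1 1)" by (simp add: monom_altdef)
    then show ?thesis by (simp only: smult_power monom_power) simp
  qed
  have dvdB: "monom 1 r dvd q \<longleftrightarrow> [:0, - 1:] ^ r dvd q" for q :: "complex poly"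
    unfolding B by (simp add: smult_dvd_iff)
  show ?thesis
  proof
    assume ?L
    then obtain c where c: "\<And>k. k \<le> m \<Longrightarrow> c k \<noteq> 0 \<Longrightarrow> r \<le> k \<and> k + e \<le> m"
      "p = (\<Sum>k\<le>m. smult (c k) ([:1, 2:] ^ (m - k) * [:0, - 1:] ^ k))" by blast
    have "degree ([:1, 2 :: complex:] ^ (m - k) * [:0, - 1:] ^ k) \<le> m" if "k \<le> m" for k
      using degree_mult_le[of "[:1, 2 :: complex:] ^ (m - k)" "[:0, - 1:] ^ k"]
        degree_power_le[of "[:1, 2 :: complex:]" "m - k"] degree_power_le[of "[:0, - 1 :: complex:]" k] that
      by simp
    then have "degree p \<le> m"
      unfolding c(2) by (intro degree_sum_le order.trans[OF degree_smult_le]) auto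
    moreover have "[:0, - 1:] ^ r dvd p"
      unfolding c(2)
    proof (rule dvd_sum)
      fix k assume k: "k \<in> {..m}"
      show "[:0, - 1:] ^ r dvd smult (c k) ([:1, 2:] ^ (m - k) * [:0, - 1:] ^ k)"
      proof (cases "c k = 0")
        case False
        then show ?thesis using c(1)[of k] k by (intro dvd_smult dvd_mult le_imp_power_dvd) auto
      qed simp
    qed
    moreover have "[:1, 2:] ^ e dvd p"
      unfolding c(2)
    proof (rule dvd_sum)
      fix k assume k: "k \<in> {..m}"
      show "[:1, 2:] ^ e dvd smult (c k) ([:1, 2:] ^ (m - k) * [:0, - 1:] ^ k)"
      proof (cases "c k = 0")
        case False
        then show ?thesis using c(1)[of k] k by (intro dvd_smult dvd_mult2 le_imp_power_dvd) auto
      qed simp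
    qed
    ultimately show ?R by (simp add: dvdB)
  next
    assume R: ?R
    show ?L
    proof (cases "p = 0")
      case True
      then show ?thesis by (intro exI[of _ "\<lambda>_. 0"]) simp
    next
      case False
      from R obtain g where g: "p = monom 1 r * g" by (auto elim: dvdE)
      have "[:1, 2:] ^ e dvd g"
        using R coprime_form_powers[of e r] unfolding g by (simp add: coprime_dvd_mult_right_iff)
      then obtain h' where h': "g = [:1, 2:] ^ e * h'" by (auto elim: dvdE)
      \<comment> \<open>Absorbs the sign between T^r and (-T)^r.\<close>
      define h where "h = smult ((- 1) ^ r) h'"
      have p: "p = [:0, - 1:] ^ r * ([:1, 2:] ^ e * h)"
        unfolding g h' h_def B by (simp add: mult_ac flip: power_mult_distrib)
      have nz: "h \<noteq> 0" using False p by auto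
      have "degree p = r + (e + degree h)"
        unfolding p using nz by (simp add: degree_mult_eq degree_power_eq)
      then have N: "degree h \<le> m - r - e" "r + e \<le> m" using R by auto
      define N where "N = m - r - e"
      from binary_form_span[OF N(1)] obtain d where
        d: "h = (\<Sum>k\<le>N. smult (d k) ([:1, 2:] ^ (N - k) * [:0, - 1:] ^ k))" unfolding N_def by blast
      \<comment> \<open>Multiplication by (-T)^r shifts the index by \<open>r\<close>.\<close>
      define c where "c k = (if r \<le> k \<and> k \<le> N + r then d (k - r) else 0)" for k
      have "p = (\<Sum>k\<le>N. smult (d k) ([:1, 2:] ^ (m - (k + r)) * [:0, - 1:] ^ (k + r)))"
      proof -
        have "p = (\<Sum>k\<le>N. smult (d k) (([:1, 2:] ^ e * [:1, 2:] ^ (N - k)) * ([:0, - 1:] ^ k * [:0, - 1:] ^ r)))"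
          unfolding p d sum_distrib_left by (simp add: mult_ac)
        also have "\<dots> = (\<Sum>k\<le>N. smult (d k) ([:1, 2:] ^ (m - (k + r)) * [:0, - 1:] ^ (k + r)))"
        proof (rule sum.cong[OF refl])
          fix k assume "k \<in> {..N}"
          then have "e + (N - k) = m - (k + r)" using N(2) by (simp add: N_def)
          then show "smult (d k) (([:1, 2:] ^ e * [:1, 2:] ^ (N - k)) * ([:0, - 1:] ^ k * [:0, - 1:] ^ r)) =
              smult (d k) ([:1, 2:] ^ (m - (k + r)) * [:0, - 1:] ^ (k + r))"
            by (simp flip: power_add)
        qed
        finally show ?thesis .
      qed
      also have "\<dots> = (\<Sum>k\<in>{0..N}. smult (c (k + r)) ([:1, 2:] ^ (m - (k + r)) * [:0, - 1:] ^ (k + r)))"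
        by (rule sum.cong) (auto simp: c_def)
      also have "\<dots> = (\<Sum>k\<in>{r..N + r}. smult (c k) ([:1, 2:] ^ (m - k) * [:0, - 1:] ^ k))"
        using sum.shift_bounds_cl_nat_ivl[of "\<lambda>k. smult (c k) ([:1, 2:] ^ (m - k) * [:0, - 1:] ^ k)" 0 r N]
        by simp
      also have "\<dots> = (\<Sum>k\<le>m. smult (c k) ([:1, 2:] ^ (m - k) * [:0, - 1:] ^ k))"
        by (rule sum.mono_neutral_left) (use N(2) in \<open>auto simp: c_def N_def\<close>)
      finally have "p = (\<Sum>k\<le>m. smult (c k) ([:1, 2:] ^ (m - k) * [:0, - 1:] ^ k))" .
      moreover have "\<forall>k\<le>m. c k \<noteq> 0 \<longrightarrow> r \<le> k \<and> k + e \<le> m"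
        using N(2) by (auto simp: c_def N_def)
      ultimately show ?thesis by blast
    qed
  qed
qed

text \<open>In the third chart the coefficient of (d v)^(m-k) (d w)^k contains 1/t to the power 2 a
  - b - k. Its regularity bounds the exponent m - k of 1 + 2 T from below by m - 2 a + b;
  \<open>nat\<close> makes a negative bound void.\<close>

definition pole_order :: "nat \<Rightarrow> weight \<Rightarrow> nat" where
  "pole_order m u = nat (int m - 2 * fst u + snd u)"

lemma admissible_yt:
  "chart.admissible (1, 2) (0, - 1) bv False m u p \<longleftrightarrow> degree p \<le> m \<and>
    monom 1 (if bv then 0 else nat (int m - fst u)) dvd p \<and> [:1, 2:] ^ pole_order m u dvd p"
proof -
  interpret chart "(1, 2)" "(0, - 1)" bv False by unfold_locales auto
  have "u - wt m k \<in> chart_cone (1, 2) (0, - 1) bv False \<longleftrightarrow>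
      (if bv then 0 else nat (int m - fst u)) \<le> k \<and> k + pole_order m u \<le> m" if "k \<le> m" for k
    using that by (cases bv) (auto simp: wt_def comb_def chart_cone_yt of_nat_diff pole_order_def nat_le_iff)
  moreover have "lin (1, 2) = [:1, 2:]" "lin (0, - 1) = [:0, - 1:]" by (simp_all add: lin_def)
  ultimately show ?thesis
    unfolding admissible_def binary_form_truncated[symmetric] by (auto cong: conj_cong)
qed

text \<open>The sections over Y - E in weight \<open>u\<close>. The bound by \<open>snd u\<close> is
  put on coefficients rather than on the degree, so that it forces \<open>p = 0\<close> when
  \<open>snd u\<close> is negative.\<close>

definition fibre :: "nat \<Rightarrow> weight \<Rightarrow> complex poly \<Rightarrow> bool" where
  "fibre m u p \<longleftrightarrow> degree p \<le> m \<and> (\<forall>k. coeff p k \<noteq> 0 \<longrightarrow> int k \<le> snd u) \<and>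
     [:1, 2:] ^ pole_order m u dvd p"

lemma all_idx: "(\<forall>i. P i) \<longleftrightarrow> P I1 \<and> P I2 \<and> P I3"
  by (metis idx.exhaust)

lemma global_forms_True: "F \<in> global_forms True m \<longleftrightarrow> (\<forall>u. fibre m u (lookup F u))"
  unfolding global_forms_iff_admissible all_idx fibre_def
  by (auto simp: admissible_xt admissible_yt)

lemma global_forms_False:
  "F \<in> global_forms False m \<longleftrightarrow>
    (\<forall>u. fibre m u (lookup F u) \<and> monom 1 (nat (int m - fst u)) dvd lookup F u)"
proof -
  have "monom 1 (nat (int m - x)) dvd p \<longleftrightarrow> (\<forall>k. coeff p k \<noteq> 0 \<longrightarrow> int m - x \<le> int k)"
    for x and p :: "complex poly"
    unfolding monom_1_dvd_iff' by (metis nat_le_iff not_le)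
  then show ?thesis
    unfolding global_forms_iff_admissible all_idx fibre_def
    by (auto simp: admissible_xt admissible_yt)
qed

section \<open>The dimension of a quotient\<close>

text \<open>An exchange argument that avoids the quotient space: the elements of \<open>B'\<close>
  are congruent modulo \<open>W\<close> to combinations of \<open>B\<close>, and the finitely many
  differences span a space with a finite basis \<open>C\<close> inside \<open>W\<close>. Then
  \<open>B' \<union> C\<close> is independent and lies in the span of \<open>B \<union> C\<close>.
  It makes the choice in \<open>quot_dim\<close> harmless.\<close>

lemma (in vector_space) quot_basis_card_le:
  assumes W: "subspace W" and B: "quot_basis scale V W B" and B': "quot_basis scale V W B'"
  shows "card B' \<le> card B"
proof -
  have fin: "finite B" "finite B'" using B B' by (auto simp: quot_basis_def)
  have "\<forall>b\<in>B'. \<exists>u. b - (\<Sum>a\<in>B. u a *s a) \<in> W"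
    using B B' unfolding quot_basis_def by blast
  then obtain u where u: "\<And>b. b \<in> B' \<Longrightarrow> b - (\<Sum>a\<in>B. u b a *s a) \<in> W" by metis
  define R where "R = (\<lambda>b. b - (\<Sum>a\<in>B. u b a *s a)) ` B'"
  have R: "finite R" "R \<subseteq> W" using fin u by (auto simp: R_def)
  obtain C where C: "C \<subseteq> R" "independent C" "R \<subseteq> span C"
    using maximal_independent_subset[of R] by auto
  have finC: "finite C" using C(1) R(1) finite_subset by blast
  have CW: "C \<subseteq> W" using C(1) R(2) by blast
  have indB': "f b = 0" if "(\<Sum>b\<in>B'. f b *s b) \<in> W" "b \<in> B'" for f b
    using B' that unfolding quot_basis_def by blast
  have disj: "B' \<inter> C = {}"
  proof (rule ccontr)
    assume "B' \<inter> C \<noteq> {}"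
    then obtain x where x: "x \<in> B'" "x \<in> C" by auto
    have "(\<Sum>b\<in>B'. (if b = x then 1 else 0) *s b) = (\<Sum>b\<in>B'. if b = x then x else 0)"
      by (rule sum.cong) auto
    also have "\<dots> = x" using x fin by simp
    finally have "(\<Sum>b\<in>B'. (if b = x then 1 else 0) *s b) \<in> W" using x CW by auto
    from indB'[OF this x(1)] show False by simp
  qed
  have "independent (B' \<union> C)"
  proof (rule independent_if_scalars_zero)
    fix f x assume 0: "(\<Sum>x\<in>B' \<union> C. f x *s x) = 0" and x: "x \<in> B' \<union> C"
    have split: "(\<Sum>x\<in>B'. f x *s x) + (\<Sum>x\<in>C. f x *s x) = 0"
      using 0 fin finC disj by (simp add: sum.union_disjoint)
    have "- (\<Sum>x\<in>C. f x *s x) \<in> W"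
      using CW by (intro subspace_neg subspace_sum subspace_scale W) auto
    moreover have "(\<Sum>x\<in>B'. f x *s x) = - (\<Sum>x\<in>C. f x *s x)"
      using split by (simp add: eq_neg_iff_add_eq_0)
    ultimately have fB': "f b = 0" if "b \<in> B'" for b using indB'[of f b] that by simp
    then have "(\<Sum>x\<in>C. f x *s x) = 0" using split by simp
    then have "f c = 0" if "c \<in> C" for c
      using independentD[OF C(2) finC subset_refl, of f c] that by simp
    with fB' x show "f x = 0" by blast
  qed (use fin finC in simp)
  moreover have "B' \<union> C \<subseteq> span (B \<union> C)"
  proof
    fix x assume "x \<in> B' \<union> C"
    then show "x \<in> span (B \<union> C)"
    proof
      assume x: "x \<in> B'"
      have "x - (\<Sum>a\<in>B. u x a *s a) \<in> span (B \<union> C)"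
        using C(3) x span_mono[of C "B \<union> C"] by (auto simp: R_def)
      moreover have "(\<Sum>a\<in>B. u x a *s a) \<in> span (B \<union> C)"
        by (intro span_sum span_scale span_base) auto
      ultimately show ?thesis using span_add[of "x - (\<Sum>a\<in>B. u x a *s a)"] by fastforce
    qed (auto intro: span_base)
  qed
  ultimately have "card (B' \<union> C) \<le> card (B \<union> C)"
    using independent_span_bound[of "B \<union> C" "B' \<union> C"] fin finC by simp
  also have "\<dots> \<le> card B + card C" by (rule card_Un_le)
  finally show ?thesis using disj fin finC by (simp add: card_Un_disjoint)
qed

lemma quot_dim_eq:
  assumes "vector_space scale" "module.subspace scale W" "quot_basis scale V W B"
  shows "quot_dim scale V W = enat (card B)"
proof -
  interpret vector_space scale by (rule assms(1))
  have "quot_basis scale V W (SOME B. quot_basis scale V W B)" using assms(3) by (rule someI)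
  then have "card (SOME B. quot_basis scale V W B) = card B"
    using assms(2,3) quot_basis_card_le by (intro antisym) blast+
  then show ?thesis using assms(3) by (auto simp: quot_dim_def)
qed

section \<open>A basis of the space of forms modulo extendable forms\<close>

text \<open>The pair \<open>(a, b)\<close> is the weight and \<open>i\<close> the power of T. The
  truncated subtraction \<open>m + b - 2 * a\<close> agrees with \<open>pole_order\<close>.\<close>

definition basis_index :: "nat \<Rightarrow> (nat \<times> nat \<times> nat) set" where
  "basis_index m = {(a, b, i). a < m \<and> b \<le> 2 * a \<and> i < m - a \<and> i + (m + b - 2 * a) \<le> min m b}"

definition basis_poly :: "nat \<Rightarrow> nat \<times> nat \<times> nat \<Rightarrow> complex poly" where
  "basis_poly m = (\<lambda>(a, b, i). [:1, 2:] ^ (m + b - 2 * a) * monom 1 i)"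

definition basis_weight :: "nat \<times> nat \<times> nat \<Rightarrow> weight" where
  "basis_weight = (\<lambda>(a, b, i). (int a, int b))"

definition basis_form :: "nat \<Rightarrow> nat \<times> nat \<times> nat \<Rightarrow> form" where
  "basis_form m \<tau> = single (basis_weight \<tau>) (basis_poly m \<tau>)"

lemma finite_basis_index: "finite (basis_index m)"
  by (rule finite_subset[of _ "{..<m} \<times> {..2 * m} \<times> {..<m}"]) (auto simp: basis_index_def)

lemma pole_order_nat: "pole_order m (int a, int b) = m + b - 2 * a"
  by (simp add: pole_order_def)

lemma degree_basis_poly: "degree (basis_poly m (a, b, i)) = (m + b - 2 * a) + i"
  by (simp add: basis_poly_def degree_mult_eq degree_power_eq degree_monom_eq)

lemma basis_poly_nonzero: "basis_poly m \<tau> \<noteq> 0"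
  by (cases \<tau>) (simp add: basis_poly_def)

lemma basis_form_inj: "inj (basis_form m)"
proof (rule injI)
  fix \<tau> \<tau>' assume eq: "basis_form m \<tau> = basis_form m \<tau>'"
  then have "keys (basis_form m \<tau>) = keys (basis_form m \<tau>')" by simp
  then have w: "basis_weight \<tau> = basis_weight \<tau>'"
    by (simp add: basis_form_def keys_single basis_poly_nonzero)
  with eq have p: "basis_poly m \<tau> = basis_poly m \<tau>'"
    unfolding basis_form_def by (metis lookup_single_eq)
  obtain a b i a' b' i' where \<tau>: "\<tau> = (a, b, i)" "\<tau>' = (a', b', i')" by (metis prod_cases3)
  with w have "a = a'" "b = b'" by (auto simp: basis_weight_def)
  with arg_cong[OF p, of degree] show "\<tau> = \<tau>'" by (simp add: \<tau> degree_basis_poly)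
qed

lemma fibre_zero: "fibre m u 0"
  by (simp add: fibre_def)

lemma fibre_diff: "fibre m u p \<Longrightarrow> fibre m u q \<Longrightarrow> fibre m u (p - q)"
  unfolding fibre_def by (auto intro: degree_diff_le dvd_diff) (metis diff_self)

lemma fibre_add: "fibre m u p \<Longrightarrow> fibre m u q \<Longrightarrow> fibre m u (p + q)"
  unfolding fibre_def by (auto intro: degree_add_le dvd_add) (metis add_0)

lemma fibre_smult: "fibre m u p \<Longrightarrow> fibre m u (smult c p)"
  unfolding fibre_def by (auto intro: dvd_smult)

lemma basis_form_global: "\<tau> \<in> basis_index m \<Longrightarrow> basis_form m \<tau> \<in> global_forms True m"
proof -
  assume "\<tau> \<in> basis_index m"
  then obtain a b i where \<tau>: "\<tau> = (a, b, i)" "i + (m + b - 2 * a) \<le> min m b"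
    by (auto simp: basis_index_def)
  have "int k \<le> int b" if "coeff (basis_poly m (a, b, i)) k \<noteq> 0" for k
    using le_degree[OF that] \<tau>(2) by (simp add: degree_basis_poly)
  then have "fibre m (int a, int b) (basis_poly m (a, b, i))"
    using \<tau>(2) by (auto simp: fibre_def degree_basis_poly pole_order_nat) (simp add: basis_poly_def)
  then show ?thesis
    unfolding global_forms_True basis_form_def \<tau>(1)
    by (simp add: lookup_single when_def basis_weight_def fibre_zero)
qed

definition basis_comb :: "nat \<Rightarrow> (nat \<times> nat \<times> nat \<Rightarrow> complex) \<Rightarrow> form" where
  "basis_comb m c = (\<Sum>\<tau>\<in>basis_index m. single 0 [:c \<tau>:] * basis_form m \<tau>)"

lemma lookup_basis_comb:
  "lookup (basis_comb m c) u =
    (\<Sum>\<tau>\<in>{\<tau>\<in>basis_index m. basis_weight \<tau> = u}. smult (c \<tau>) (basis_poly m \<tau>))"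
proof -
  have "lookup (basis_comb m c) u =
      (\<Sum>\<tau>\<in>basis_index m. if basis_weight \<tau> = u then smult (c \<tau>) (basis_poly m \<tau>) else 0)"
    unfolding basis_comb_def basis_form_def
    by (simp add: lookup_sum mult_single lookup_single when_def)
  then show ?thesis by (simp add: sum.inter_filter finite_basis_index)
qed

definition fibre_index :: "nat \<Rightarrow> nat \<Rightarrow> nat \<Rightarrow> nat set" where
  "fibre_index m a b = {i. i < m - a \<and> i + (m + b - 2 * a) \<le> min m b}"

lemma finite_fibre_index: "finite (fibre_index m a b)"
  by (rule finite_subset[of _ "{..<m}"]) (auto simp: fibre_index_def)

lemma lookup_basis_comb_nat:
  assumes "a < m" "b \<le> 2 * a"
  shows "lookup (basis_comb m c) (int a, int b) =
    [:1, 2:] ^ (m + b - 2 * a) * (\<Sum>i\<in>fibre_index m a b. monom (c (a, b, i)) i)"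
proof -
  have "{\<tau> \<in> basis_index m. basis_weight \<tau> = (int a, int b)} = (\<lambda>i. (a, b, i)) ` fibre_index m a b"
    using assms by (auto simp: basis_index_def basis_weight_def fibre_index_def)
  moreover have "inj_on (\<lambda>i. (a, b, i)) (fibre_index m a b)" by (auto intro: inj_onI)
  ultimately show ?thesis
    unfolding lookup_basis_comb
    by (simp add: sum.reindex basis_poly_def sum_distrib_left smult_monom flip: mult_smult_right)
qed

lemma basis_comb_global: "basis_comb m c \<in> global_forms True m"
  unfolding global_forms_True
proof
  fix u
  have "fibre m u (\<Sum>\<tau>\<in>K. smult (c \<tau>) (basis_poly m \<tau>))"
    if "finite K" "K \<subseteq> {\<tau>\<in>basis_index m. basis_weight \<tau> = u}" for K
    using that
  proof (induction K rule: finite_induct)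
    case (insert \<tau> K)
    then have "fibre m u (lookup (basis_form m \<tau>) u)"
      using basis_form_global[of \<tau> m] unfolding global_forms_True by blast
    then have "fibre m u (basis_poly m \<tau>)" using insert by (simp add: basis_form_def lookup_single)
    then show ?case using insert by (auto intro!: fibre_add fibre_smult)
  qed (simp add: fibre_zero)
  then show "fibre m u (lookup (basis_comb m c) u)"
    unfolding lookup_basis_comb by (simp add: finite_basis_index)
qed

lemma global_forms_fibre: "F \<in> global_forms True m \<Longrightarrow> fibre m u (lookup F u)"
  unfolding global_forms_True by blast

text \<open>The leading coefficient gives the degree bound, hence \<open>0 \<le> snd u\<close>. A
  power of 1 + 2 T that divides a nonzero polynomial of degree at most \<open>m\<close> has exponent
  at most \<open>m\<close>, which for \<open>pole_order\<close> means
  \<open>snd u \<le> 2 * fst u\<close>.\<close>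

lemma fibre_nonzero_bounds:
  assumes "fibre m u p" "p \<noteq> 0"
  shows "0 \<le> snd u \<and> snd u \<le> 2 * fst u \<and> int (degree p) \<le> snd u"
proof -
  have "int (degree p) \<le> snd u" using assms by (auto simp: fibre_def)
  moreover have "pole_order m u \<le> m"
  proof -
    have "degree ([:1, 2 :: complex:] ^ pole_order m u) \<le> degree p"
      using assms by (intro dvd_imp_degree_le) (auto simp: fibre_def)
    then show ?thesis using assms by (simp add: degree_power_eq fibre_def)
  qed
  then have "snd u \<le> 2 * fst u" by (simp add: pole_order_def nat_le_iff)
  ultimately show ?thesis by simp
qed

text \<open>In each weight the form is (1 + 2 T)^e h; cutting \<open>h\<close> off below T^(m - a)
  gives the combination of basis forms, and the rest is divisible by T^(m - a).\<close>

lemma basis_spans: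
  assumes F: "F \<in> global_forms True m"
  shows "\<exists>c. F - basis_comb m c \<in> global_forms False m"
proof -
  have "\<exists>h. lookup F (int a, int b) = [:1, 2:] ^ (m + b - 2 * a) * h" for a b
    using F[unfolded global_forms_True, rule_format, of "(int a, int b)"]
    by (auto simp: fibre_def pole_order_nat dvd_def)
  then obtain h where h: "\<And>a b. lookup F (int a, int b) = [:1, 2:] ^ (m + b - 2 * a) * h a b" by metis
  define c where "c = (\<lambda>(a, b, i). coeff (h a b) i)"
  have fib: "fibre m u (lookup F u)" for u using F by (rule global_forms_fibre)
  have "monom 1 (nat (int m - fst u)) dvd lookup (F - basis_comb m c) u" for u
  proof (cases "fst u < int m \<and> 0 \<le> snd u \<and> snd u \<le> 2 * fst u")
    case False
    then consider "int m \<le> fst u" | "snd u < 0 \<or> snd u > 2 * fst u" by linarith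
    then show ?thesis
    proof cases
      case 1
      then show ?thesis by simp
    next
      case 2
      then have "lookup F u = 0" "lookup (basis_comb m c) u = 0"
        using fibre_nonzero_bounds[of m u "lookup F u"] fibre_nonzero_bounds[of m u "lookup (basis_comb m c) u"] fib
          global_forms_fibre[OF basis_comb_global] by (metis not_le)+
      then show ?thesis by (simp add: lookup_minus)
    qed
  next
    case True
    define a b where "a = nat (fst u)" and "b = nat (snd u)"
    have u: "u = (int a, int b)" and ab: "a < m" "b \<le> 2 * a"
      using True by (auto simp: a_def b_def prod_eq_iff)
    \<comment> \<open>The degree bound on \<open>lookup F u\<close> already excludes these powers of
      T, so the basis forms account for the whole truncation.\<close>
    have "coeff (h a b) k = 0" if k: "k < m - a" "k \<notin> fibre_index m a b" for k
    proof (rule ccontr)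
      assume nz: "coeff (h a b) k \<noteq> 0"
      then have "h a b \<noteq> 0" by auto
      then have "degree (lookup F u) = (m + b - 2 * a) + degree (h a b)" "lookup F u \<noteq> 0"
        by (simp_all add: u h degree_mult_eq degree_power_eq)
      moreover have "degree (lookup F u) \<le> m" "int (degree (lookup F u)) \<le> int b"
        using fib[of u] fibre_nonzero_bounds[OF fib[of u] calculation(2)] by (auto simp: fibre_def u)
      ultimately show False using le_degree[OF nz] k by (simp add: fibre_index_def)
    qed
    then have "monom 1 (m - a) dvd h a b - (\<Sum>i\<in>fibre_index m a b. monom (coeff (h a b) i) i)"
      unfolding monom_1_dvd_iff'
      by (simp add: coeff_sum finite_fibre_index)
    moreover have "lookup (F - basis_comb m c) u =
        [:1, 2:] ^ (m + b - 2 * a) * (h a b - (\<Sum>i\<in>fibre_index m a b. monom (coeff (h a b) i) i))"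
      unfolding u lookup_minus lookup_basis_comb_nat[OF ab] h
      by (simp add: c_def right_diff_distrib)
    moreover have "nat (int m - fst u) = m - a" by (simp add: u)
    ultimately show ?thesis by (simp only: dvd_mult)
  qed
  moreover have "fibre m u (lookup (F - basis_comb m c) u)" for u
    unfolding lookup_minus by (intro fibre_diff fib global_forms_fibre basis_comb_global)
  ultimately show ?thesis unfolding global_forms_False by blast
qed

text \<open>Coprimality with the power of 1 + 2 T passes divisibility by T^(m - a) on to the
  cofactor, whose exponents are all below m - a.\<close>

lemma basis_independent:
  assumes G: "basis_comb m c \<in> global_forms False m" and \<tau>: "\<tau> \<in> basis_index m"
  shows "c \<tau> = 0"
proof -
  obtain a b i where abi: "\<tau> = (a, b, i)" "a < m" "b \<le> 2 * a" "i \<in> fibre_index m a b"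
    using \<tau> by (auto simp: basis_index_def fibre_index_def)
  have "monom 1 (nat (int m - int a)) dvd lookup (basis_comb m c) (int a, int b)"
    using G unfolding global_forms_False by (metis fst_conv)
  then have "monom 1 (m - a) dvd
      [:1, 2:] ^ (m + b - 2 * a) * (\<Sum>i\<in>fibre_index m a b. monom (c (a, b, i)) i)"
    using abi by (simp add: lookup_basis_comb_nat nat_diff_distrib)
  moreover have "coprime (monom 1 (m - a)) ([:1, 2 :: complex:] ^ (m + b - 2 * a))"
    by (subst coprime_commute) (rule coprime_form_powers)
  ultimately have "monom 1 (m - a) dvd (\<Sum>i\<in>fibre_index m a b. monom (c (a, b, i)) i)"
    by (simp add: coprime_dvd_mult_right_iff)
  then have "coeff (\<Sum>i\<in>fibre_index m a b. monom (c (a, b, i)) i) i = 0"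
    using abi(4) unfolding monom_1_dvd_iff' by (simp add: fibre_index_def)
  then show ?thesis using abi by (simp add: coeff_sum finite_fibre_index)
qed

section \<open>The dimension as a number of lattice points\<close>

lemma Ev_scale_section:
  assumes "\<omega> \<in> sym_sections m (chart_alg b)"
  shows "Ev.eval (scale_section c \<omega> i) = single 0 [:c:] * Ev.eval (\<omega> i)"
proof -
  have "const c \<in> monring UNIV" using const_mon_in_monring[of 0 UNIV c] by simp
  moreover have "\<omega> i \<in> with_coeffs (monring UNIV)"
    using assms by (auto simp: sym_sections_iff intro: chart_alg_homogeneous_laurent)
  ultimately show ?thesis
    by (simp add: scale_section_def Ev.eval_mult coeff_poly_in Ev_coeff_poly \<kappa>_const)
qed

lemma sym_sections_scale:
  assumes \<omega>: "\<omega> \<in> sym_sections m (chart_alg b)"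
  shows "scale_section c \<omega> \<in> sym_sections m (chart_alg b)"
  unfolding sym_sections_iff
proof (intro conjI allI)
  fix i j
  have "coeff_poly (const c) * \<omega> i \<in> homogeneous_diff_polys (0 + m) (chart_alg b i)"
    using \<omega> by (intro homogeneous_mult homogeneous_coeff_poly subring_chart_alg)
      (auto simp: sym_sections_iff chart_alg_def intro: subalgebra_gen.const)
  then show "scale_section c \<omega> i \<in> homogeneous_diff_polys m (chart_alg b i)"
    by (simp add: scale_section_def)
  show "Ev.eval (scale_section c \<omega> i) = Ev.eval (scale_section c \<omega> j)"
    using \<omega> unfolding Ev_scale_section[OF \<omega>] by (metis sym_sections_iff)
qed

lemma Ev_section_add:
  assumes "\<omega> \<in> sym_sections m (chart_alg b)" "\<eta> \<in> sym_sections m (chart_alg b)"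
  shows "Ev.eval ((\<omega> + \<eta>) i) = Ev.eval (\<omega> i) + Ev.eval (\<eta> i)"
    and "Ev.eval ((\<omega> - \<eta>) i) = Ev.eval (\<omega> i) - Ev.eval (\<eta> i)"
proof -
  have "\<omega> i \<in> with_coeffs (monring UNIV)" "\<eta> i \<in> with_coeffs (monring UNIV)"
    using assms by (auto simp: sym_sections_iff intro: chart_alg_homogeneous_laurent)
  then show "Ev.eval ((\<omega> + \<eta>) i) = Ev.eval (\<omega> i) + Ev.eval (\<eta> i)"
    "Ev.eval ((\<omega> - \<eta>) i) = Ev.eval (\<omega> i) - Ev.eval (\<eta> i)"
    by (simp_all add: Ev.eval_add Ev.eval_diff)
qed

lemma sym_sections_add:
  assumes \<omega>: "\<omega> \<in> sym_sections m (chart_alg b)" and \<eta>: "\<eta> \<in> sym_sections m (chart_alg b)"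
  shows "\<omega> + \<eta> \<in> sym_sections m (chart_alg b)" "\<omega> - \<eta> \<in> sym_sections m (chart_alg b)"
  unfolding sym_sections_iff Ev_section_add[OF assms]
  using assms by (auto simp: sym_sections_iff intro: homogeneous_add homogeneous_diff subring_chart_alg)
    (metis (no_types))+

lemma sym_sections_zero: "0 \<in> sym_sections m (chart_alg b)"
  by (simp add: sym_sections_iff homogeneous_zero subring_chart_alg)

lemma sym_sections_sum:
  assumes "\<And>x. x \<in> A \<Longrightarrow> f x \<in> sym_sections m (chart_alg b)"
  shows "sum f A \<in> sym_sections m (chart_alg b) \<and> Ev.eval (sum f A i) = (\<Sum>x\<in>A. Ev.eval (f x i))"
  using assms
proof (induction A rule: infinite_finite_induct)
  case (insert x A)
  then have "f x \<in> sym_sections m (chart_alg b)" "sum f A \<in> sym_sections m (chart_alg b)" by auto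
  note sym_sections_add(1)[OF this] Ev_section_add(1)[OF this, of i]
  with insert show ?case by (simp del: plus_fun_apply)
qed (simp_all add: sym_sections_zero)

lemma extendable_subspace: "module.subspace scale_section (extendable m)"
proof -
  interpret vector_space scale_section by (rule vector_space_scale_section)
  have sc: "single 0 [:c:] * F \<in> global_forms False m" if "F \<in> global_forms False m" for c F
  proof -
    have "lookup (single 0 [:c:] * F) u = smult c (lookup F u)" for u
      using lookup_mult_single[of F 0 "[:c:]" u] by (simp add: mult.commute)
    then show ?thesis using that by (auto simp: global_forms_False intro: fibre_smult dvd_smult)
  qed
  have add: "F + G \<in> global_forms False m" if "F \<in> global_forms False m" "G \<in> global_forms False m" for F G
    using that by (auto simp: global_forms_False lookup_add intro: fibre_add dvd_add)
  show ?thesis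
  proof (rule subspaceI)
    show "0 \<in> extendable m"
      by (simp add: extendable_iff sym_sections_zero global_forms_False fibre_zero)
  next
    fix \<omega> \<eta> assume "\<omega> \<in> extendable m" "\<eta> \<in> extendable m"
    then have V: "\<omega> \<in> sym_sections m (chart_alg True)" "\<eta> \<in> sym_sections m (chart_alg True)"
      and "Ev.eval (\<omega> I1) \<in> global_forms False m" "Ev.eval (\<eta> I1) \<in> global_forms False m"
      by (simp_all add: extendable_iff)
    then show "\<omega> + \<eta> \<in> extendable m"
      unfolding extendable_iff Ev_section_add(1)[OF V] using sym_sections_add(1)[OF V] add by blast
  next
    fix c \<omega> assume "\<omega> \<in> extendable m"
    then have V: "\<omega> \<in> sym_sections m (chart_alg True)" and "Ev.eval (\<omega> I1) \<in> global_forms False m"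
      by (simp_all add: extendable_iff)
    then show "scale_section c \<omega> \<in> extendable m"
      unfolding extendable_iff Ev_scale_section[OF V] using sym_sections_scale[OF V] sc by blast
  qed
qed

lemma chi0_card: "chi0 m = enat (card (basis_index m))"
proof -
  let ?V = "sym_sections m (chart_alg True)"
  have "\<exists>s. \<forall>\<tau>\<in>basis_index m. s \<tau> \<in> ?V \<and> Ev.eval (s \<tau> I1) = basis_form m \<tau>"
    using sym_sections_onto[OF basis_form_global] by (intro bchoice) blast
  then obtain s where s: "\<And>\<tau>. \<tau> \<in> basis_index m \<Longrightarrow> s \<tau> \<in> ?V"
    "\<And>\<tau>. \<tau> \<in> basis_index m \<Longrightarrow> Ev.eval (s \<tau> I1) = basis_form m \<tau>" by blast
  define B where "B = s ` basis_index m"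
  \<comment> \<open>The lifts are distinct because their values, the basis forms, are
    distinct.\<close>
  have inj: "inj_on s (basis_index m)"
    using s(2) basis_form_inj by (metis inj_onI inj_def)
  have comb: "(\<Sum>b\<in>B. scale_section (c b) b) \<in> ?V \<and>
      Ev.eval ((\<Sum>b\<in>B. scale_section (c b) b) I1) = basis_comb m (c \<circ> s)" for c
  proof -
    have "(\<Sum>b\<in>B. scale_section (c b) b) = (\<Sum>\<tau>\<in>basis_index m. scale_section (c (s \<tau>)) (s \<tau>))"
      unfolding B_def by (simp add: sum.reindex[OF inj])
    moreover have "(\<Sum>\<tau>\<in>basis_index m. Ev.eval (scale_section (c (s \<tau>)) (s \<tau>) I1)) = basis_comb m (c \<circ> s)"
      unfolding basis_comb_def by (rule sum.cong) (simp_all add: Ev_scale_section[OF s(1)] s(2))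
    ultimately show ?thesis
      using sym_sections_sum[of "basis_index m" "\<lambda>\<tau>. scale_section (c (s \<tau>)) (s \<tau>)" m True I1]
        sym_sections_scale[OF s(1)] by simp
  qed
  have "quot_basis scale_section ?V (extendable m) B"
    unfolding quot_basis_def
  proof (intro conjI ballI allI impI)
    show "finite B" by (simp add: B_def finite_basis_index)
    show "B \<subseteq> ?V" using s(1) by (auto simp: B_def)
  next
    fix \<omega> assume \<omega>: "\<omega> \<in> ?V"
    from basis_spans[OF sym_sections_eval[OF \<omega>]] obtain c where
      c: "Ev.eval (\<omega> I1) - basis_comb m c \<in> global_forms False m" by blast
    define c' where "c' b = c (inv_into (basis_index m) s b)" for b
    have c': "basis_comb m (c' \<circ> s) = basis_comb m c"
      unfolding basis_comb_def by (rule sum.cong) (simp_all add: c'_def inj)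
    show "\<exists>u. \<omega> - (\<Sum>b\<in>B. scale_section (u b) b) \<in> extendable m"
    proof (rule exI[of _ c'])
      have V: "(\<Sum>b\<in>B. scale_section (c' b) b) \<in> ?V" using comb by blast
      show "\<omega> - (\<Sum>b\<in>B. scale_section (c' b) b) \<in> extendable m"
        unfolding extendable_iff Ev_section_add(2)[OF \<omega> V]
        using sym_sections_add(2)[OF \<omega> V] c comb[of c'] c' by simp
    qed
  next
    fix c b assume "(\<Sum>b\<in>B. scale_section (c b) b) \<in> extendable m" and b: "b \<in> B"
    then have "basis_comb m (c \<circ> s) \<in> global_forms False m"
      using comb[of c] by (simp add: extendable_iff)
    from basis_independent[OF this] b show "c b = 0" by (auto simp: B_def)
  qed
  from quot_dim_eq[OF vector_space_scale_section extendable_subspace this]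
  show ?thesis by (simp add: chi0_eq B_def card_image[OF inj])
qed

text \<open>
  For fixed \<open>a\<close> and \<open>i\<close>, the conditions on \<open>b\<close> amount to \<open>i \<le> b \<le> 2 a - i\<close>, and they can be met only
  if \<open>i + m \<le> 2 a\<close>.
\<close>

lemma card_basis_index:
  "card (basis_index m) = (\<Sum>a<m. \<Sum>i<min (m - a) (2 * a + 1 - m). 2 * a - i + 1 - i)"
proof -
  \<comment> \<open>Moving \<open>b\<close> to the innermost place makes its range an interval. With
    truncated subtraction \<open>i < 2 * a + 1 - m\<close> still means
    \<open>i + m \<le> 2 * a\<close>.\<close>
  let ?I = "SIGMA a:{..<m}. SIGMA i:{..<min (m - a) (2 * a + 1 - m)}. {i..2 * a - i}"
  have "\<tau> \<in> basis_index m \<longleftrightarrow> \<tau> \<in> (\<lambda>(a, i, b). (a, b, i)) ` ?I" for \<tau>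
  proof -
    obtain a b i where \<tau>: "\<tau> = (a, b, i)" by (metis prod_cases3)
    have "\<tau> \<in> (\<lambda>(a, i, b). (a, b, i)) ` ?I \<longleftrightarrow> (a, i, b) \<in> ?I"
      by (auto simp: \<tau> image_iff)
    also have "\<dots> \<longleftrightarrow> a < m \<and> b \<le> 2 * a \<and> i < m - a \<and> i + (m + b - 2 * a) \<le> min m b"
      by auto
    finally show ?thesis by (simp add: basis_index_def \<tau>)
  qed
  then have "basis_index m = (\<lambda>(a, i, b). (a, b, i)) ` ?I" by blast
  moreover have "inj_on (\<lambda>(a, i, b). (a, b, i)) ?I" by (auto intro!: inj_onI)
  ultimately show ?thesis by (simp add: card_image card_SigmaI)
qed

text \<open>The summands 2 a + 1 - 2 i form an arithmetic progression; the bound on \<open>k\<close>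
  keeps the truncated subtractions exact.\<close>

lemma sum_odd_descending:
  "k \<le> a + 1 \<Longrightarrow> real (\<Sum>i<k. 2 * a - i + 1 - i) = real k * (2 * real a + 2 - real k)"
proof (induction k)
  case (Suc k)
  then have "real (2 * a - k + 1 - k) = 2 * real a + 1 - 2 * real k" by simp
  with Suc show ?case by (simp add: algebra_simps)
qed simp

lemma sum_telescope:
  fixes f g :: "nat \<Rightarrow> real"
  assumes "m \<le> n" "\<And>i. m \<le> i \<Longrightarrow> i < n \<Longrightarrow> f i = g (Suc i) - g i"
  shows "(\<Sum>i=m..<n. f i) = g n - g m"
proof -
  have "(\<Sum>i=m..<n. f i) = (\<Sum>i=m..<n. g (Suc i) - g i)" by (rule sum.cong) (auto simp: assms)
  also have "\<dots> = g n - g m" using assms(1) by (rule sum_Suc_diff')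
  finally show ?thesis .
qed

text \<open>
  Antiderivatives of the two branches of the inner sum: the minimum of \<open>m - a\<close> and \<open>2 a + 1 - m\<close> is the
  latter for \<open>3 a < 2 m\<close> (\<open>low_sum\<close>) and the former for \<open>3 a \<ge> 2 m\<close> (\<open>high_sum\<close>).
\<close>

definition low_sum :: "real \<Rightarrow> real \<Rightarrow> real" where
  "low_sum m n = (m + 1) * (n ^ 2 - m * n)"

definition high_sum :: "real \<Rightarrow> real \<Rightarrow> real" where
  "high_sum m n = - n * (n - 1) * (2 * n - 1) / 2 + (2 * m - 1) * n * (n - 1) + m * (2 - m) * n"

text \<open>Here \<open>p\<close> is m/2 rounded up, the first \<open>a\<close> with a nonempty
  inner range, and \<open>q\<close> is 2m/3 rounded up, where the branches change. The real
  variables allow substitution of linear expressions in one parameter.\<close>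

lemma card_basis_index_closed:
  assumes "m \<ge> 1" "(m + 1) div 2 = p" "(2 * m + 2) div 3 = q"
    and M: "real m = M" "real p = P" "real q = Q"
  shows "real (card (basis_index m)) =
    low_sum M Q - low_sum M P + high_sum M M - high_sum M Q"
proof -
  define f where "f a = real (\<Sum>i<min (m - a) (2 * a + 1 - m). 2 * a - i + 1 - i)" for a
  have le: "p \<le> q" "q \<le> m" using assms(1-3) by auto
  have f0: "f a = 0" if "a < p" for a
    using that assms(2) by (simp add: f_def)
  have f1: "f a = low_sum M (Suc a) - low_sum M a" if "p \<le> a" "a < q" for a
  proof -
    have *: "min (m - a) (2 * a + 1 - m) = 2 * a + 1 - m" "m \<le> 2 * a + 1" "2 * a + 1 - m \<le> a + 1"
      using that assms(1-3) by auto
    then have "f a = (2 * real a + 1 - real m) * (2 * real a + 2 - (2 * real a + 1 - real m))"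
      unfolding f_def *(1) sum_odd_descending[OF *(3)] by (simp add: of_nat_diff)
    then show ?thesis by (simp add: low_sum_def power2_eq_square algebra_simps flip: M(1))
  qed
  have f2: "f a = high_sum M (Suc a) - high_sum M a" if "q \<le> a" "a < m" for a
  proof -
    have *: "min (m - a) (2 * a + 1 - m) = m - a" "a \<le> m" "m - a \<le> a + 1"
      using that assms(1-3) by auto
    then have "f a = (real m - real a) * (2 * real a + 2 - (real m - real a))"
      unfolding f_def *(1) sum_odd_descending[OF *(3)] by (simp add: of_nat_diff)
    then show ?thesis by (simp add: high_sum_def field_simps flip: M(1))
  qed
  have "real (card (basis_index m)) = (\<Sum>a=0..<m. f a)"
    by (simp add: card_basis_index f_def atLeast0LessThan)
  also have "\<dots> = (\<Sum>a=0..<p. f a) + (\<Sum>a=p..<q. f a) + (\<Sum>a=q..<m. f a)"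
    using le by (simp add: sum.atLeastLessThan_concat)
  also have "(\<Sum>a=0..<p. f a) = 0" by (simp add: f0)
  also have "(\<Sum>a=p..<q. f a) = low_sum M q - low_sum M p" by (rule sum_telescope) (use le f1 in auto)
  also have "(\<Sum>a=q..<m. f a) = high_sum M m - high_sum M q" by (rule sum_telescope) (use le f2 in auto)
  finally show ?thesis by (simp add: M)
qed

text \<open>The period 6 comes from rounding m/2 and 2m/3: in each residue class both are linear in
  \<open>m div 6\<close>, and a polynomial identity remains.\<close>

lemma card_basis_index_quasipolynomial:
  assumes "m \<ge> 1"
  shows "real (card (basis_index m)) =
    (if m mod 6 = 0 then 11/108 * real m ^ 3 + 11/36 * real m ^ 2 + 1/6 * real m
     else if m mod 6 = 1 then 11/108 * real m ^ 3 + 11/36 * real m ^ 2 - 1/12 * real m - 35/108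
     else if m mod 6 = 2 then 11/108 * real m ^ 3 + 11/36 * real m ^ 2 + 7/18 * real m + 5/27
     else if m mod 6 = 3 then 11/108 * real m ^ 3 + 11/36 * real m ^ 2 - 1/12 * real m - 1/4
     else if m mod 6 = 4 then 11/108 * real m ^ 3 + 11/36 * real m ^ 2 + 1/6 * real m - 2/27
     else 11/108 * real m ^ 3 + 11/36 * real m ^ 2 + 5/36 * real m - 7/108)"
proof -
  define k where "k = m div 6"
  define x where "x = real k"
  have "m mod 6 < 6" by simp
  then consider "m mod 6 = 0" | "m mod 6 = 1" | "m mod 6 = 2" | "m mod 6 = 3" | "m mod 6 = 4" | "m mod 6 = 5"
    by linarith
  then show ?thesis
  proof cases
    case 1
    then have m: "m = 6 * k" unfolding k_def by presburger
    then have "(m + 1) div 2 = 3 * k" "(2 * m + 2) div 3 = 4 * k" by presburger+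
    then have "real (card (basis_index m)) = low_sum (6 * x) (4 * x) -
        low_sum (6 * x) (3 * x) + high_sum (6 * x) (6 * x) -
        high_sum (6 * x) (4 * x)"
      by (rule card_basis_index_closed[OF assms]) (simp_all add: m x_def)
    also have "\<dots> = 11/108 * (6 * x) ^ 3 + 11/36 * (6 * x) ^ 2 + 1/6 * (6 * x)"
      unfolding low_sum_def high_sum_def by algebra
    also have "6 * x = real m" by (simp add: m x_def)
    finally show ?thesis using 1 by simp
  next
    case 2
    then have m: "m = 6 * k + 1" unfolding k_def by presburger
    then have "(m + 1) div 2 = 3 * k + 1" "(2 * m + 2) div 3 = 4 * k + 1" by presburger+
    then have "real (card (basis_index m)) = low_sum (6 * x + 1) (4 * x + 1) -
        low_sum (6 * x + 1) (3 * x + 1) + high_sum (6 * x + 1) (6 * x + 1) -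
        high_sum (6 * x + 1) (4 * x + 1)"
      by (rule card_basis_index_closed[OF assms]) (simp_all add: m x_def)
    also have "\<dots> = 11/108 * (6 * x + 1) ^ 3 + 11/36 * (6 * x + 1) ^ 2 - 1/12 * (6 * x + 1) - 35/108"
      unfolding low_sum_def high_sum_def by algebra
    also have "6 * x + 1 = real m" by (simp add: m x_def)
    finally show ?thesis using 2 by simp
  next
    case 3
    then have m: "m = 6 * k + 2" unfolding k_def by presburger
    then have "(m + 1) div 2 = 3 * k + 1" "(2 * m + 2) div 3 = 4 * k + 2" by presburger+
    then have "real (card (basis_index m)) = low_sum (6 * x + 2) (4 * x + 2) -
        low_sum (6 * x + 2) (3 * x + 1) + high_sum (6 * x + 2) (6 * x + 2) -
        high_sum (6 * x + 2) (4 * x + 2)"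
      by (rule card_basis_index_closed[OF assms]) (simp_all add: m x_def)
    also have "\<dots> = 11/108 * (6 * x + 2) ^ 3 + 11/36 * (6 * x + 2) ^ 2 + 7/18 * (6 * x + 2) + 5/27"
      unfolding low_sum_def high_sum_def by algebra
    also have "6 * x + 2 = real m" by (simp add: m x_def)
    finally show ?thesis using 3 by simp
  next
    case 4
    then have m: "m = 6 * k + 3" unfolding k_def by presburger
    then have "(m + 1) div 2 = 3 * k + 2" "(2 * m + 2) div 3 = 4 * k + 2" by presburger+
    then have "real (card (basis_index m)) = low_sum (6 * x + 3) (4 * x + 2) -
        low_sum (6 * x + 3) (3 * x + 2) + high_sum (6 * x + 3) (6 * x + 3) -
        high_sum (6 * x + 3) (4 * x + 2)"
      by (rule card_basis_index_closed[OF assms]) (simp_all add: m x_def)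
    also have "\<dots> = 11/108 * (6 * x + 3) ^ 3 + 11/36 * (6 * x + 3) ^ 2 - 1/12 * (6 * x + 3) - 1/4"
      unfolding low_sum_def high_sum_def by algebra
    also have "6 * x + 3 = real m" by (simp add: m x_def)
    finally show ?thesis using 4 by simp
  next
    case 5
    then have m: "m = 6 * k + 4" unfolding k_def by presburger
    then have "(m + 1) div 2 = 3 * k + 2" "(2 * m + 2) div 3 = 4 * k + 3" by presburger+
    then have "real (card (basis_index m)) = low_sum (6 * x + 4) (4 * x + 3) -
        low_sum (6 * x + 4) (3 * x + 2) + high_sum (6 * x + 4) (6 * x + 4) -
        high_sum (6 * x + 4) (4 * x + 3)"
      by (rule card_basis_index_closed[OF assms]) (simp_all add: m x_def)
    also have "\<dots> = 11/108 * (6 * x + 4) ^ 3 + 11/36 * (6 * x + 4) ^ 2 + 1/6 * (6 * x + 4) - 2/27"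
      unfolding low_sum_def high_sum_def by algebra
    also have "6 * x + 4 = real m" by (simp add: m x_def)
    finally show ?thesis using 5 by simp
  next
    case 6
    then have m: "m = 6 * k + 5" unfolding k_def by presburger
    then have "(m + 1) div 2 = 3 * k + 3" "(2 * m + 2) div 3 = 4 * k + 4" by presburger+
    then have "real (card (basis_index m)) = low_sum (6 * x + 5) (4 * x + 4) -
        low_sum (6 * x + 5) (3 * x + 3) + high_sum (6 * x + 5) (6 * x + 5) -
        high_sum (6 * x + 5) (4 * x + 4)"
      by (rule card_basis_index_closed[OF assms]) (simp_all add: m x_def)
    also have "\<dots> = 11/108 * (6 * x + 5) ^ 3 + 11/36 * (6 * x + 5) ^ 2 + 5/36 * (6 * x + 5) - 7/108"
      unfolding low_sum_def high_sum_def by algebra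
    also have "6 * x + 5 = real m" by (simp add: m x_def)
    finally show ?thesis using 6 by simp
  qed
qed

theorem proposition3p3:
  shows "(\<forall>m::nat. m \<ge> 1 \<longrightarrow>
      ereal_of_enat (chi0 m) = ereal (
        if m mod 6 = 0 then 11/108 * real m ^ 3 + 11/36 * real m ^ 2 + 1/6 * real m
        else if m mod 6 = 1 then 11/108 * real m ^ 3 + 11/36 * real m ^ 2 - 1/12 * real m - 35/108
        else if m mod 6 = 2 then 11/108 * real m ^ 3 + 11/36 * real m ^ 2 + 7/18 * real m + 5/27
        else if m mod 6 = 3 then 11/108 * real m ^ 3 + 11/36 * real m ^ 2 - 1/12 * real m - 1/4
        else if m mod 6 = 4 then 11/108 * real m ^ 3 + 11/36 * real m ^ 2 + 1/6 * real m - 2/27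
        else 11/108 * real m ^ 3 + 11/36 * real m ^ 2 + 5/36 * real m - 7/108)) \<and>
    map chi0 [1, 2, 3, 4, 5, 6, 7, 8, 9, 10, 11, 12] =
      [0, 3, 5, 12, 21, 34, 49, 75, 98, 134, 174, 222]"
proof (intro conjI allI impI)
  fix m :: nat assume "m \<ge> 1"
  from card_basis_index_quasipolynomial[OF this] show "ereal_of_enat (chi0 m) = ereal (
        if m mod 6 = 0 then 11/108 * real m ^ 3 + 11/36 * real m ^ 2 + 1/6 * real m
        else if m mod 6 = 1 then 11/108 * real m ^ 3 + 11/36 * real m ^ 2 - 1/12 * real m - 35/108
        else if m mod 6 = 2 then 11/108 * real m ^ 3 + 11/36 * real m ^ 2 + 7/18 * real m + 5/27
        else if m mod 6 = 3 then 11/108 * real m ^ 3 + 11/36 * real m ^ 2 - 1/12 * real m - 1/4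
        else if m mod 6 = 4 then 11/108 * real m ^ 3 + 11/36 * real m ^ 2 + 1/6 * real m - 2/27
        else 11/108 * real m ^ 3 + 11/36 * real m ^ 2 + 5/36 * real m - 7/108)"
    by (simp only: chi0_card ereal_of_enat_simps)
next
  \<comment> \<open>The listed values are read off from the closed formula, which lives over the
    reals.\<close>
  have card: "card (basis_index m) = n" if "real (card (basis_index m)) = real n" for m n
    using that by simp
  have "card (basis_index 1) = 0" "card (basis_index 2) = 3" "card (basis_index 3) = 5"
    "card (basis_index 4) = 12" "card (basis_index 5) = 21" "card (basis_index 6) = 34"
    "card (basis_index 7) = 49" "card (basis_index 8) = 75" "card (basis_index 9) = 98"
    "card (basis_index 10) = 134" "card (basis_index 11) = 174" "card (basis_index 12) = 222"
    by (rule card, subst card_basis_index_quasipolynomial; simp)+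
  then show "map chi0 [1, 2, 3, 4, 5, 6, 7, 8, 9, 10, 11, 12] =
      [0, 3, 5, 12, 21, 34, 49, 75, 98, 134, 174, 222]"
    by (simp add: chi0_card numeral_eq_enat zero_enat_def)
qed

end
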